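(* Let $f:\mathbb{R}^n\to\mathbb{R}^n$ be a convex monotone homogeneous map that has a fixed point, let $\mathscr{G}_1,\dots,\mathscr{G}_s$ be the strongly connected components of its critical graph $\mathscr{G}^{c}(f)$, and let $C=N^{c}(f)$ be the set of critical nodes. Then the restriction $\mathsf{r}_C:\mathbb{R}^n\to\mathbb{R}^C$, $x\mapsto(x_i)_{i\in C}$, sends bijectively the union of the periodic orbits of $f$, which is equal to $\mathscr{E}(f^{\mathsf{c}(f)})=\{x\in\mathbb{R}^n\mid f^{\mathsf{c}(f)}(x)=x\}$, to a convex inf-subsemilattice of $\mathbb{R}^C$ whose dimension is at most equal to $\mathsf{m}(f^{\mathsf{c}(f)})=\mathsf{c}(\mathscr{G}_1)+\cdots+\mathsf{c}(\mathscr{G}_s)$.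
   Context: $\leq$ is the entrywise order of $\mathbb{R}^n$ and $\lambda+x=(\lambda+x_1,\dots,\lambda+x_n)$. A map $f$ is monotone if $x\le y\Rightarrow f(x)\le f(y)$, (additively) homogeneous if $f(\lambda+x)=\lambda+f(x)$ for all $\lambda\in\mathbb{R}$, and convex if each coordinate is convex. $f^k$ is the $k$-th iterate. A periodic orbit of $f$ is a set $\{f^k(x)\}_{k\in\mathbb{N}}$ with $f^c(x)=x$ for some $c\ge1$. An inf-subsemilattice of $\mathbb{R}^C$ is a subset stable under entrywise minimum; the dimension of a convex set is that of its affine hull. For a convex monotone homogeneous map $g$ with an eigenvector $v$ ($g(v)=\lambda+v$, $\lambda\in\mathbb{R}$; e.g. a fixed point), let $\partial g(v)=\{P\in\mathbb{R}^{n\times n}\mid g(x)-g(v)\ge P(x-v)\ \forall x\}$, whose elements are stochastic matrices. For a stochastic matrix $P$, $\mathscr{G}(P)$ is the directed graph on $\{1,\dots,n\}$ with arcs $i\to j$ when $P_{ij}\neq0$; its classes are the equivalence classes for mutual accessibility (each node has access to itself), a class is final if no node in it has access to a node outside it, and $\mathscr{G}^{f}(P)$ is the restriction of $\mathscr{G}(P)$ to the union of the final classes. The critical graph is $\mathscr{G}^{c}(g)=\bigcup_{P\in\partial g(v)}\mathscr{G}^{f}(P)$; it does not depend on the choice of $v$. $N^{c}(g)$ is its set of nodes; the critical classes of $g$ are the node sets of its strongly connected components, and $\mathsf{m}(g)$ is the number of critical classes. The cyclicity $\mathsf{c}(\mathscr{G})$ of a strongly connected graph $\mathscr{G}$ is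 the gcd of the lengths of its circuits, and $\mathsf{c}(f)=\mathrm{lcm}(\mathsf{c}(\mathscr{G}_1),\dots,\mathsf{c}(\mathscr{G}_s))$. *)

theory Defs
  imports "HOL-Analysis.Analysis" "Graph_Theory.Digraph_Component"
begin

text \<open>The order on \<^typ>\<open>real ^ 'n\<close> is the entrywise one, \<^const>\<open>mono\<close> is
  monotonicity for it, and \<^term>\<open>vec l + x\<close> is the vector with entries \<open>l + x\<^sub>i\<close>.\<close>

definition additively_homogeneous :: "(real ^ 'n \<Rightarrow> real ^ 'n) \<Rightarrow> bool" where
  "additively_homogeneous f \<longleftrightarrow> (\<forall>l x. f (vec l + x) = vec l + f x)"

definition coordinatewise_convex :: "(real ^ 'n \<Rightarrow> real ^ 'n) \<Rightarrow> bool" where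
  "coordinatewise_convex f \<longleftrightarrow> (\<forall>i. convex_on UNIV (\<lambda>x. f x $ i))"

definition eigenvector :: "(real ^ 'n \<Rightarrow> real ^ 'n) \<Rightarrow> real ^ 'n \<Rightarrow> bool" where
  "eigenvector g v \<longleftrightarrow> (\<exists>l. g v = vec l + v)"

definition subdifferential ::
    "(real ^ 'n \<Rightarrow> real ^ 'n) \<Rightarrow> real ^ 'n \<Rightarrow> (real ^ 'n ^ 'n) set" where
  "subdifferential g v = {P. \<forall>x. g x - g v \<ge> P *v (x - v)}"

definition periodic_orbits :: "('a \<Rightarrow> 'a) \<Rightarrow> 'a set set" where
  "periodic_orbits f = {{(f ^^ k) x | k. True} | x. \<exists>c\<ge>1. (f ^^ c) x = x}"


type_synonym 'n graph = "('n, 'n \<times> 'n) pre_digraph"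

definition matrix_graph :: "real ^ 'n ^ 'n \<Rightarrow> 'n graph" where
  "matrix_graph P =
     \<lparr>verts = UNIV, arcs = {(i, j). P $ i $ j \<noteq> 0}, tail = fst, head = snd\<rparr>"

text \<open>\<^const>\<open>pre_digraph.sccs_verts\<close> gives the classes of mutual accessibility; every
  node of a graph is reachable from itself.\<close>

definition final_classes :: "'n graph \<Rightarrow> 'n set set" where
  "final_classes G =
     {S \<in> pre_digraph.sccs_verts G. \<forall>i\<in>S. \<forall>j. i \<rightarrow>\<^sup>*\<^bsub>G\<^esub> j \<longrightarrow> j \<in> S}"

definition final_graph :: "real ^ 'n ^ 'n \<Rightarrow> 'n graph" where
  "final_graph P = matrix_graph P \<restriction> \<Union>(final_classes (matrix_graph P))"

definition critical_graph_at :: "(real ^ 'n \<Rightarrow> real ^ 'n) \<Rightarrow> real ^ 'n \<Rightarrow> 'n graph" where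
  "critical_graph_at g v =
     \<lparr>verts = (\<Union>P\<in>subdifferential g v. verts (final_graph P)),
      arcs = (\<Union>P\<in>subdifferential g v. arcs (final_graph P)),
      tail = fst, head = snd\<rparr>"

text \<open>For convex monotone homogeneous \<open>g\<close> the graph \<^term>\<open>critical_graph_at g v\<close> is the
  same for all eigenvectors \<open>v\<close>, so the eigenvector that is picked here does not matter.
  For a map without eigenvectors the value is meaningless.\<close>

definition critical_graph :: "(real ^ 'n \<Rightarrow> real ^ 'n) \<Rightarrow> 'n graph" where
  "critical_graph g = critical_graph_at g (SOME v. eigenvector g v)"

abbreviation critical_nodes :: "(real ^ 'n \<Rightarrow> real ^ 'n) \<Rightarrow> 'n set" where
  "critical_nodes g \<equiv> verts (critical_graph g)"

abbreviation critical_components :: "(real ^ 'n \<Rightarrow> real ^ 'n) \<Rightarrow> 'n graph set" where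
  "critical_components g \<equiv> pre_digraph.sccs (critical_graph g)"

definition critical_classes :: "(real ^ 'n \<Rightarrow> real ^ 'n) \<Rightarrow> 'n set set" where
  "critical_classes g = verts ` critical_components g"

definition num_critical_classes :: "(real ^ 'n \<Rightarrow> real ^ 'n) \<Rightarrow> nat" where
  "num_critical_classes g = card (critical_classes g)"

text \<open>A circuit is a closed walk of positive length, not necessarily elementary; the gcd
  is the same for elementary circuits, into which every closed walk decomposes.\<close>

definition graph_cyclicity :: "'n graph \<Rightarrow> nat" where
  "graph_cyclicity G = Gcd {length p | u p. pre_digraph.awalk G u p u \<and> p \<noteq> []}"

definition map_cyclicity :: "(real ^ 'n \<Rightarrow> real ^ 'n) \<Rightarrow> nat" where
  "map_cyclicity f = Lcm (graph_cyclicity ` critical_components f)"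


text \<open>For a set \<open>C\<close> of indices, \<open>\<real>\<^sup>C\<close> is identified with the subspace of the vectors of
  \<^typ>\<open>real ^ 'n\<close> whose entries outside \<open>C\<close> are zero. Linear structure, entrywise
  minimum \<^const>\<open>inf\<close> and affine dimension \<^const>\<open>aff_dim\<close> of subsets of \<open>\<real>\<^sup>C\<close> agree
  with those inherited from \<^typ>\<open>real ^ 'n\<close>.\<close>

definition coordinate_space :: "'n set \<Rightarrow> (real ^ 'n) set" where
  "coordinate_space C = {y. \<forall>i. i \<notin> C \<longrightarrow> y $ i = 0}"

definition restrict_coords :: "'n set \<Rightarrow> real ^ 'n \<Rightarrow> real ^ 'n" where
  "restrict_coords C x = (\<chi> i. if i \<in> C then x $ i else 0)"

definition inf_subsemilattice :: "'n set \<Rightarrow> (real ^ 'n) set \<Rightarrow> bool" where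
  "inf_subsemilattice C S \<longleftrightarrow>
     S \<subseteq> coordinate_space C \<and> (\<forall>x\<in>S. \<forall>y\<in>S. inf x y \<in> S)"

end

theory Submission
  imports Defs "HOL-Number_Theory.Cong"
begin

text \<open>Only the supports of the rows of the elements of \<open>\<partial>g(v)\<close> matter for the critical graph: it is
  the largest relation \<open>E\<close> such that every successor set \<open>E `` {i}\<close> is such a support and every arc
  can be returned along \<open>E\<close>. A chain rule for supports gives \<open>\<G>\<^sup>c(f\<^sup>k) = \<G>\<^sup>c(f)\<^sup>k\<close>, and the
  classes of \<open>\<G>\<^sup>c(f)\<^sup>k\<close> are counted by periods.

  If \<open>g(z) \<le> z\<close> and \<open>g(v) = v\<close>, then \<open>z - v\<close> is superharmonic for the rows that realise the
  critical graph, hence constant on critical classes, and \<open>g(z) = z\<close> on critical nodes. So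
  \<open>g\<^sup>k(z)\<close> decreases to a fixed point that agrees with \<open>z\<close> there; applied to convex combinations and
  minima of fixed points this gives the structure of the image, and the classes bound its dimension.
  The minimum principle on a final class yields injectivity. Finally, a periodic point \<open>x\<close> satisfies
  \<open>f\<^sup>c(x) \<ge> x\<close> on critical nodes; running along the orbit forces equality.\<close>

section \<open>Recurrent relations\<close>

text \<open>Supports suffice because the subdifferential is a product over rows and the subgradients
  of a row are nonnegative and form a convex set: averaging two of them unites their supports
  without cancellation. This closure under unions makes the largest recurrent relation exist and be
  realised by a single matrix. It also removes the obstacle for iterates: a subgradient of
  \<open>f ^^ k\<close> may use different rows of f at the same node at different times, and merging
  these rows gives one relation that serves at all times. In the chain rule it means that a given
  subgradient of a composition need not be factored; for each entry that it charges, a factored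
  subgradient charging this entry and nothing outside the given support is enough. The periods enter
  the dynamics through one fact: a walk whose length is divisible by the period of its class joins
  two nodes of the same class of \<open>E ^^ N\<close>, for every N > 0. With N a multiple of the
  cyclicity c and of a period of x, the critical rows of \<open>f ^^ c\<close> therefore reproduce
  every function that is constant on the classes of \<open>E ^^ N\<close>.\<close>

lemma sym_rtrancl_if_converse_subset:
  assumes "E\<inverse> \<subseteq> E\<^sup>*"
  shows "sym (E\<^sup>*)"
proof -
  have "(E\<^sup>*)\<inverse> \<subseteq> E\<^sup>*"
    using rtrancl_mono[OF assms] by (simp add: rtrancl_converse)
  then show ?thesis by (auto simp: sym_def)
qed

lemma equiv_rtrancl_if_converse_subset:
  assumes "E\<inverse> \<subseteq> E\<^sup>*"
  shows "equiv UNIV (E\<^sup>*)"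
  using sym_rtrancl_if_converse_subset[OF assms] by (simp add: equiv_def refl_rtrancl trans_rtrancl)

lemma relpow_returns:
  assumes "E\<inverse> \<subseteq> E\<^sup>*" "(a, b) \<in> E ^^ m"
  obtains l where "(b, a) \<in> E ^^ l"
proof -
  have "(b, a) \<in> E\<^sup>*"
    using sym_rtrancl_if_converse_subset[OF assms(1)] relpow_imp_rtrancl[OF assms(2)] by (blast dest: symD)
  then show thesis using that by (auto simp: rtrancl_power)
qed

text \<open>The return walk of an arc leaves its head and enters its tail, unless it is empty and
  the arc is a loop.\<close>

lemma Field_eq_Domain_Range:
  assumes "E\<inverse> \<subseteq> E\<^sup>*"
  shows "Field E = Domain E" "Field E = Range E"
proof -
  have "b \<in> Domain E" "a \<in> Range E" if "(a, b) \<in> E" for a b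
  proof -
    have "(b, a) \<in> E\<^sup>*" using assms that by auto
    then show "b \<in> Domain E" using that by (cases rule: converse_rtranclE) auto
    from \<open>(b, a) \<in> E\<^sup>*\<close> show "a \<in> Range E" using that by (cases rule: rtranclE) auto
  qed
  then show "Field E = Domain E" "Field E = Range E" by (auto simp: Field_def)
qed

lemma rtrancl_closed_Field:
  assumes "(a, b) \<in> E\<^sup>*" "a \<in> Field E"
  shows "b \<in> Field E"
  using assms by (induction rule: rtrancl_induct) (auto simp: Field_def)

lemma relpow_serial:
  assumes "E\<inverse> \<subseteq> E\<^sup>*" "a \<in> Field E"
  shows "\<exists>b. (a, b) \<in> E ^^ k"
proof (induction k)
  case (Suc k)
  then obtain b where b: "(a, b) \<in> E ^^ k" by blast
  then have "b \<in> Domain E"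
    using rtrancl_closed_Field[OF relpow_imp_rtrancl assms(2)] Field_eq_Domain_Range(1)[OF assms(1)] by blast
  with b show ?case by auto
qed auto

lemma relpow_add_trans:
  "(a, b) \<in> E ^^ m \<Longrightarrow> (b, c) \<in> E ^^ n \<Longrightarrow> (a, c) \<in> E ^^ (m + n)"
  by (auto simp: relpow_add)

lemma relpow_mono:
  fixes E F :: "'a rel"
  assumes "E \<subseteq> F"
  shows "E ^^ k \<subseteq> F ^^ k"
  by (induction k) (use assms in auto)

lemma relpow_loop:
  assumes "(a, a) \<in> E ^^ m"
  shows "(a, a) \<in> E ^^ (m * n)"
  by (induction n) (auto intro: relpow_add_trans[OF assms])

lemma relpow_mult: "(E :: 'a rel) ^^ (m * n) = (E ^^ m) ^^ n"
proof (induction n)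
  case (Suc n)
  have "E ^^ (m * Suc n) = E ^^ (m * n + m)" by (simp add: add.commute)
  then show ?case by (simp only: relpow_add Suc relpow.simps)
qed simp

lemma relpow_mult_imp_rtrancl:
  assumes "(a, b) \<in> E ^^ (k * m)"
  shows "(a, b) \<in> (E ^^ k)\<^sup>*"
  using assms unfolding relpow_mult by (rule relpow_imp_rtrancl)

lemma rtrancl_relpow_subset: "(E ^^ k)\<^sup>* \<subseteq> E\<^sup>*"
  by (metis relpow_imp_rtrancl rtrancl_subset_rtrancl subrelI)

text \<open>A return walk of length l from b to a is followed by k - 1 rounds of the closed walk a
  -> b -> a of length k + l; the total l + (k + l)(k - 1) = k(k - 1 + l) is a multiple of k.\<close>

lemma converse_relpow_subset:
  assumes "E\<inverse> \<subseteq> E\<^sup>*" "k > 0"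
  shows "(E ^^ k)\<inverse> \<subseteq> (E ^^ k)\<^sup>*"
proof
  fix x assume "x \<in> (E ^^ k)\<inverse>"
  then obtain a b where x: "x = (b, a)" and ab: "(a, b) \<in> E ^^ k" by auto
  obtain l where l: "(b, a) \<in> E ^^ l" using relpow_returns[OF assms(1) ab] .
  have "(a, a) \<in> E ^^ ((k + l) * (k - 1))"
    using relpow_loop[OF relpow_add_trans[OF ab l]] .
  then have "(b, a) \<in> E ^^ (l + (k + l) * (k - 1))" by (rule relpow_add_trans[OF l])
  moreover have "l + (k + l) * (k - 1) = k * (k - 1 + l)"
    using \<open>k > 0\<close> by (cases k) (auto simp: algebra_simps)
  ultimately show "x \<in> (E ^^ k)\<^sup>*" using relpow_mult_imp_rtrancl x by metis
qed

lemma Field_relpow: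
  assumes "E\<inverse> \<subseteq> E\<^sup>*" "k > 0"
  shows "Field (E ^^ k) = Field E"
proof
  show "Field (E ^^ k) \<subseteq> Field E"
  proof
    fix a assume "a \<in> Field (E ^^ k)"
    then have "a \<in> Domain (E ^^ k)"
      using Field_eq_Domain_Range(1)[OF converse_relpow_subset[OF assms]] by simp
    then obtain b where "(a, b) \<in> E ^^ Suc (k - 1)" using \<open>k > 0\<close> by auto
    then show "a \<in> Field E"
      by (blast dest: relpow_Suc_D2 intro: FieldI1)
  qed
  show "Field E \<subseteq> Field (E ^^ k)"
    using relpow_serial[OF assms(1)] by (fastforce simp: Field_def)
qed

section \<open>Cyclicity classes\<close>

text \<open>Walks run in all of E. For a class S of a recurrent relation they cannot leave S, so
  this is the cyclicity of the component on S.\<close>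

definition period :: "'a rel \<Rightarrow> 'a set \<Rightarrow> nat" where
  "period E S = Gcd {l. l > 0 \<and> (\<exists>a\<in>S. (a, a) \<in> E ^^ l)}"

text \<open>Modulo N a submonoid is a subgroup, (N - 1) x being inverse to x. Its least positive
  representative e divides every element of H, hence Gcd H and l; if l = e m, then (N - 1) m copies
  of an element of H congruent to e supply h.\<close>

lemma submonoid_complement:
  fixes H :: "nat set"
  assumes "0 \<in> H" and add: "\<And>x y. x \<in> H \<Longrightarrow> y \<in> H \<Longrightarrow> x + y \<in> H"
    and "N > 0" "Gcd H dvd l"
  obtains h where "h \<in> H" "N dvd l + h"
proof -
  have mult: "m * x \<in> H" if "x \<in> H" for x m
    by (induction m) (auto simp: \<open>0 \<in> H\<close> add that)
  define K where "K = {x. \<exists>h\<in>H. [h = x] (mod N)}"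
  define e where "e = (LEAST e. e > 0 \<and> e \<in> K)"
  \<comment> \<open>N represents the residue 0, so K has a positive element.\<close>
  have "N > 0 \<and> N \<in> K"
    using \<open>N > 0\<close> \<open>0 \<in> H\<close> by (auto simp: K_def cong_def intro!: bexI[of _ 0])
  then have e: "e > 0" "e \<in> K" unfolding e_def by (metis (mono_tags, lifting) LeastI)+
  then obtain he where he: "he \<in> H" "[he = e] (mod N)" by (auto simp: K_def)
  have "e dvd x" if "x \<in> H" for x
  proof (rule ccontr)
    assume "\<not> e dvd x"
    then have pos: "x mod e > 0" by (simp add: dvd_eq_mod_eq_0)
    \<comment> \<open>Reduction of x modulo e inside H: instead of subtracting x div e copies of e,
      N - 1 times as many copies of \<open>he\<close> are added.\<close>
    have "[x + (x div e) * (N - 1) * he = x + (x div e) * (N - 1) * e] (mod N)"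
      by (intro cong_add cong_mult cong_refl he)
    also have "x + (x div e) * (N - 1) * e = x mod e + N * ((x div e) * e)"
    proof -
      have "(x div e) * e + (x div e) * (N - 1) * e = N * ((x div e) * e)"
        using \<open>N > 0\<close> by (cases N) (auto simp: algebra_simps)
      then show ?thesis using div_mult_mod_eq[of x e] by linarith
    qed
    also have "[x mod e + N * ((x div e) * e) = x mod e] (mod N)"
      by (simp add: cong_def)
    finally have "x mod e \<in> K" unfolding K_def using that he by (auto intro!: add mult)
    then have "e \<le> x mod e" using pos Least_le[of "\<lambda>e. e > 0 \<and> e \<in> K" "x mod e"] by (simp add: e_def[symmetric])
    then show False using mod_less_divisor[OF \<open>e > 0\<close>, of x] by simp
  qed
  then have "e dvd l" using \<open>Gcd H dvd l\<close> by (meson Gcd_greatest dvd_trans)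
  then obtain m where m: "l = e * m" by auto
  have "[l + ((N - 1) * m) * he = l + ((N - 1) * m) * e] (mod N)"
    by (intro cong_add cong_mult cong_refl he)
  also have "l + ((N - 1) * m) * e = N * (m * e)"
    using \<open>N > 0\<close> unfolding m by (cases N) (auto simp: algebra_simps)
  finally have "N dvd l + ((N - 1) * m) * he" by (simp add: cong_def mod_eq_0_iff_dvd)
  then show thesis using that he mult by blast
qed

lemma period_dvd:
  assumes "a \<in> S" "(a, a) \<in> E ^^ l"
  shows "period E S dvd l"
  using assms unfolding period_def by (cases "l = 0") (auto intro!: Gcd_dvd)

text \<open>The lengths of closed walks at j form a submonoid. Its gcd divides the period of the
  class, because a closed walk at another node a can be inserted into a closed walk j -> a -> j and
  its length is the difference of the two. A suitable closed walk at j then completes l to a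
  multiple of N.\<close>

lemma period_dvd_imp_rtrancl_relpow:
  assumes "E\<inverse> \<subseteq> E\<^sup>*" "N > 0" "(i, j) \<in> E ^^ l" "period E (E\<^sup>* `` {j}) dvd l"
  shows "(i, j) \<in> (E ^^ N)\<^sup>*"
proof -
  let ?H = "{h. (j, j) \<in> E ^^ h}"
  have "Gcd ?H dvd x" if x: "x > 0" "(a, a) \<in> E ^^ x" and a: "(j, a) \<in> E\<^sup>*" for a x
  proof -
    from a obtain p where p: "(j, a) \<in> E ^^ p" by (auto simp: rtrancl_power)
    from relpow_returns[OF assms(1) p] obtain q where q: "(a, j) \<in> E ^^ q" .
    have "Gcd ?H dvd p + q" "Gcd ?H dvd p + x + q"
      using p q x by (auto intro!: Gcd_dvd relpow_add_trans)
    then show ?thesis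
      by (metis add.assoc add.commute dvd_add_right_iff)
  qed
  then have "Gcd ?H dvd period E (E\<^sup>* `` {j})"
    unfolding period_def by (intro Gcd_greatest) auto
  then have "Gcd ?H dvd l" using assms(4) dvd_trans by blast
  then obtain h where "(j, j) \<in> E ^^ h" "N dvd l + h"
    by (rule submonoid_complement[of ?H N l, rotated 3])
      (use \<open>N > 0\<close> in \<open>auto intro: relpow_add_trans\<close>)
  then show ?thesis
    using relpow_add_trans[OF assms(3)] relpow_mult_imp_rtrancl by (metis dvdE)
qed

text \<open>One return walk closes both walks.\<close>

lemma relpow_length_cong:
  assumes "E\<inverse> \<subseteq> E\<^sup>*" "r \<in> S" "(r, i) \<in> E ^^ l" "(r, i) \<in> E ^^ l'"
  shows "[l = l'] (mod period E S)"
proof -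
  obtain b where "(i, r) \<in> E ^^ b" using relpow_returns[OF assms(1,3)] .
  then have "period E S dvd l + b" "period E S dvd l' + b"
    using assms by (auto intro: period_dvd relpow_add_trans)
  then have "[l + b = l' + b] (mod period E S)" by (simp add: cong_def mod_eq_0_iff_dvd)
  then show ?thesis by (simp add: cong_add_rcancel_nat)
qed

lemma period_pos:
  fixes E :: "'a::finite rel"
  assumes "E\<inverse> \<subseteq> E\<^sup>*" "S \<in> Field E // E\<^sup>*"
  shows "period E S > 0"
proof -
  obtain r where r: "r \<in> Field E" "S = E\<^sup>* `` {r}" using assms(2) by (auto elim: quotientE)
  obtain s where s: "(r, s) \<in> E ^^ 1" using relpow_serial[OF assms(1) r(1)] by blast
  obtain l where "(s, r) \<in> E ^^ l" using relpow_returns[OF assms(1) s] .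
  then have "(r, r) \<in> E ^^ (1 + l)" by (rule relpow_add_trans[OF s])
  then have "period E S dvd 1 + l" using r by (intro period_dvd[of r]) auto
  then show ?thesis by (auto intro!: Nat.gr0I)
qed

text \<open>The class of a node under \<open>E ^^ k\<close> is determined by the residue, modulo the
  period, of the length of any walk to it from a fixed root r; every residue occurs.\<close>

lemma card_class_quotient_relpow:
  fixes E :: "'a::finite rel"
  assumes conv: "E\<inverse> \<subseteq> E\<^sup>*" and S: "S \<in> Field E // E\<^sup>*"
    and k: "k > 0" "period E S dvd k"
  shows "card (S // (E ^^ k)\<^sup>*) = period E S"
proof -
  obtain r where r: "r \<in> Field E" "S = E\<^sup>* `` {r}" using S by (auto elim: quotientE)
  let ?R = "(E ^^ k)\<^sup>*"
  let ?d = "period E S"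
  have eqv: "equiv UNIV ?R"
    by (rule equiv_rtrancl_if_converse_subset[OF converse_relpow_subset[OF conv k(1)]])
  \<comment> \<open>One endpoint per length t; the walks for different t are chosen
    independently.\<close>
  obtain w where w: "\<And>t. (r, w t) \<in> E ^^ t"
    using relpow_serial[OF conv r(1)] by metis
  have wS: "w t \<in> S" for t using w[of t] r by (auto dest: relpow_imp_rtrancl)
  have "inj_on (\<lambda>t. ?R `` {w t}) {..<?d}"
  proof (rule inj_onI)
    fix t t' assume t: "t \<in> {..<?d}" "t' \<in> {..<?d}" and eq: "?R `` {w t} = ?R `` {w t'}"
    have "(w t, w t') \<in> ?R" using eq by auto
    then obtain m where m: "(w t, w t') \<in> E ^^ (k * m)"
      unfolding relpow_mult by (auto simp: rtrancl_power)
    have "[t + k * m = t'] (mod ?d)"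
      using r by (intro relpow_length_cong[OF conv _ relpow_add_trans[OF w m] w]) auto
    moreover have "[t + k * m = t] (mod ?d)" using k by (simp add: cong_add_lcancel_0_nat cong_0_iff)
    ultimately have "[t = t'] (mod ?d)" by (metis cong_sym cong_trans)
    then show "t = t'" using t by (simp add: cong_def)
  qed
  moreover have "(\<lambda>t. ?R `` {w t}) ` {..<?d} = S // ?R"
  proof (intro equalityI subsetI)
    fix X assume "X \<in> S // ?R"
    then obtain i where i: "(r, i) \<in> E\<^sup>*" "X = ?R `` {i}" using r by (auto elim!: quotientE)
    then obtain l where l: "(r, i) \<in> E ^^ l" by (auto simp: rtrancl_power)
    define t where "t = l mod ?d"
    obtain b where b: "(w t, r) \<in> E ^^ b" using relpow_returns[OF conv w] .
    have l': "(w t, i) \<in> E ^^ (b + l)" using b l by (rule relpow_add_trans)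
    \<comment> \<open>The walks r -> w t -> i and r -> i have congruent lengths, and t is congruent
      to l, so the piece from w t to i has length divisible by the period.\<close>
    have "[t + (b + l) = l] (mod ?d)"
      using r by (intro relpow_length_cong[OF conv _ relpow_add_trans[OF w l'] l]) auto
    moreover have "[t + (b + l) = l + (b + l)] (mod ?d)"
      by (simp add: t_def cong_def mod_simps)
    ultimately have "[l + (b + l) = l] (mod ?d)" by (metis cong_sym cong_trans)
    then have "?d dvd b + l" by (simp add: cong_add_lcancel_0_nat cong_0_iff)
    moreover have "E\<^sup>* `` {i} = S"
      using i(1) r equiv_class_eq[OF equiv_rtrancl_if_converse_subset[OF conv] i(1)] by simp
    ultimately have "(w t, i) \<in> ?R"
      by (intro period_dvd_imp_rtrancl_relpow[OF conv k(1) l']) simp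
    then have "X = ?R `` {w t}" using equiv_class_eq[OF eqv] i by simp
    moreover have "t < ?d" using period_pos[OF conv S] by (simp add: t_def)
    ultimately show "X \<in> (\<lambda>t. ?R `` {w t}) ` {..<?d}" by auto
  qed (use wS in \<open>auto intro: quotientI\<close>)
  ultimately have "bij_betw (\<lambda>t. ?R `` {w t}) {..<?d} (S // ?R)" by (simp add: bij_betw_def)
  then show ?thesis by (auto dest: bij_betw_same_card)
qed

lemma card_quotient_relpow:
  fixes E :: "'a::finite rel"
  assumes conv: "E\<inverse> \<subseteq> E\<^sup>*" and k: "k > 0"
    and dvd: "\<And>S. S \<in> Field E // E\<^sup>* \<Longrightarrow> period E S dvd k"
  shows "card (Field E // (E ^^ k)\<^sup>*) = (\<Sum>S\<in>Field E // E\<^sup>*. period E S)"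
proof -
  let ?R = "(E ^^ k)\<^sup>*"
  have eqv: "equiv UNIV (E\<^sup>*)" by (rule equiv_rtrancl_if_converse_subset[OF conv])
  have sub: "X \<noteq> {} \<and> X \<subseteq> S" if S: "S \<in> Field E // E\<^sup>*" and X: "X \<in> S // ?R" for S X
  proof -
    obtain r where r: "S = E\<^sup>* `` {r}" using S by (auto elim: quotientE)
    obtain i where "(r, i) \<in> E\<^sup>*" "X = ?R `` {i}" using X r by (auto elim!: quotientE)
    then show ?thesis using r rtrancl_relpow_subset[of k E] by (auto dest: rtrancl_trans)
  qed
  have disj: "S \<inter> T = {}" if "S \<in> Field E // E\<^sup>*" "T \<in> Field E // E\<^sup>*" "S \<noteq> T" for S T
    using quotient_disj[OF eqv, of S T] that by (auto simp: quotient_def)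
  have "Field E // ?R = (\<Union>S\<in>Field E // E\<^sup>*. S // ?R)"
  proof (intro equalityI subsetI)
    fix X assume "X \<in> Field E // ?R"
    then obtain i where "i \<in> Field E" "X = ?R `` {i}" by (auto elim: quotientE)
    then have "X \<in> (E\<^sup>* `` {i}) // ?R" "E\<^sup>* `` {i} \<in> Field E // E\<^sup>*" by (auto intro: quotientI)
    then show "X \<in> (\<Union>S\<in>Field E // E\<^sup>*. S // ?R)" by blast
  next
    fix X assume "X \<in> (\<Union>S\<in>Field E // E\<^sup>*. S // ?R)"
    then obtain r i where "r \<in> Field E" "(r, i) \<in> E\<^sup>*" "X = ?R `` {i}"
      by (auto elim!: quotientE)
    then show "X \<in> Field E // ?R" by (auto intro: quotientI dest: rtrancl_closed_Field)
  qed
  also have "card \<dots> = (\<Sum>S\<in>Field E // E\<^sup>*. card (S // ?R))"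
  proof (rule card_UN_disjoint)
    show "\<forall>S\<in>Field E // E\<^sup>*. \<forall>T\<in>Field E // E\<^sup>*. S \<noteq> T \<longrightarrow> (S // ?R) \<inter> (T // ?R) = {}"
    proof (intro ballI impI equals0I)
      fix S T X assume *: "S \<in> Field E // E\<^sup>*" "T \<in> Field E // E\<^sup>*" "S \<noteq> T" "X \<in> (S // ?R) \<inter> (T // ?R)"
      then have "X \<noteq> {}" "X \<subseteq> S" "X \<subseteq> T" using sub[of S X] sub[of T X] by auto
      then show False using disj[OF *(1-3)] by blast
    qed
  qed simp_all
  also have "\<dots> = (\<Sum>S\<in>Field E // E\<^sup>*. period E S)"
    by (rule sum.cong[OF refl]) (rule card_class_quotient_relpow[OF conv _ k dvd])
  finally show ?thesis .
qed

section \<open>Critical relations of families of supports\<close>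

text \<open>\<open>act a\<close> lists the successor sets allowed at a, later the supports of row
  subgradients. The field can serve as node set because these supports are nonempty: a critical node
  always has an outgoing arc.\<close>

definition recurrent_rel :: "('a \<Rightarrow> 'a set set) \<Rightarrow> 'a rel \<Rightarrow> bool" where
  "recurrent_rel act E \<longleftrightarrow> (\<forall>a\<in>Field E. E `` {a} \<in> act a) \<and> E\<inverse> \<subseteq> E\<^sup>*"

definition critical_rel :: "('a \<Rightarrow> 'a set set) \<Rightarrow> 'a rel" where
  "critical_rel act = \<Union>{E. recurrent_rel act E}"

text \<open>Models the rows of a product of k matrices. The set chosen at a node may depend on the
  level and on the branch that leads to it.\<close>

fun act_power :: "('a \<Rightarrow> 'a set set) \<Rightarrow> nat \<Rightarrow> 'a \<Rightarrow> 'a set set" where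
  "act_power act 0 a = {{a}}"
| "act_power act (Suc k) a = {\<Union>(D ` B) | B D. B \<in> act a \<and> (\<forall>b\<in>B. D b \<in> act_power act k b)}"

text \<open>The three properties come from the existence of subgradients, their unit sum, and the
  average of two of them.\<close>

locale action_sets =
  fixes act :: "'a::finite \<Rightarrow> 'a set set"
  assumes act_nonempty: "act a \<noteq> {}"
    and empty_notin_act: "{} \<notin> act a"
    and act_Un: "A \<in> act a \<Longrightarrow> B \<in> act a \<Longrightarrow> A \<union> B \<in> act a"
begin

lemma act_Union:
  assumes "\<A> \<noteq> {}" "\<A> \<subseteq> act a"
  shows "\<Union>\<A> \<in> act a"
proof -
  have "finite \<A>" by simp
  then show ?thesis using assms by (induction rule: finite_ne_induct) (auto simp: act_Un)
qed

lemma recurrent_critical_rel: "recurrent_rel act (critical_rel act)"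
  unfolding recurrent_rel_def
proof
  let ?C = "critical_rel act"
  show "\<forall>a\<in>Field ?C. ?C `` {a} \<in> act a"
  proof
    fix a assume "a \<in> Field ?C"
    then obtain F where F: "recurrent_rel act F" "a \<in> Field F"
      by (auto simp: critical_rel_def Field_def)
    \<comment> \<open>Only the relations with a in their field have arcs at a, so the row of the
      union is a union of allowed sets.\<close>
    let ?\<E> = "{E. recurrent_rel act E \<and> a \<in> Field E}"
    have "?C `` {a} = \<Union>((\<lambda>E. E `` {a}) ` ?\<E>)"
      by (auto simp: critical_rel_def Field_def)
    also have "\<dots> \<in> act a"
      using F by (intro act_Union) (auto simp: recurrent_rel_def)
    finally show "?C `` {a} \<in> act a" .
  qed
  show "?C\<inverse> \<subseteq> ?C\<^sup>*"
  proof
    fix x assume "x \<in> ?C\<inverse>"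
    then obtain E where E: "recurrent_rel act E" "x \<in> E\<inverse>" by (auto simp: critical_rel_def)
    then have "x \<in> E\<^sup>*" by (auto simp: recurrent_rel_def)
    moreover have "E \<subseteq> ?C" using E by (auto simp: critical_rel_def)
    ultimately show "x \<in> ?C\<^sup>*" using rtrancl_mono by blast
  qed
qed

lemma critical_rel_upper: "recurrent_rel act E \<Longrightarrow> E \<subseteq> critical_rel act"
  by (auto simp: critical_rel_def)

lemma critical_row: "a \<in> Field (critical_rel act) \<Longrightarrow> critical_rel act `` {a} \<in> act a"
  using recurrent_critical_rel by (simp add: recurrent_rel_def)

lemma critical_converse: "(critical_rel act)\<inverse> \<subseteq> (critical_rel act)\<^sup>*"
  using recurrent_critical_rel by (simp add: recurrent_rel_def)

end

text \<open>R collects the nodes of the final classes. It is closed under E, so cutting down to R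
  changes neither the rows at its nodes nor the walks starting there.\<close>

lemma recurrent_part:
  assumes "\<And>a. E `` {a} \<in> act a" "\<And>a. {} \<notin> act a"
  defines "R \<equiv> {a. \<forall>b. (a, b) \<in> E\<^sup>* \<longrightarrow> (b, a) \<in> E\<^sup>*}"
  shows "recurrent_rel act {(a, b) \<in> E. a \<in> R}" "Field {(a, b) \<in> E. a \<in> R} = R"
proof -
  let ?E = "{(a, b) \<in> E. a \<in> R}"
  have closed: "b \<in> R" if "a \<in> R" "(a, b) \<in> E\<^sup>*" for a b
    using that unfolding R_def by (blast intro: rtrancl_trans)
  show Field: "Field ?E = R"
  proof
    show "Field ?E \<subseteq> R" using closed by (auto simp: Field_def)
    have "E `` {a} \<noteq> {}" for a using assms(1)[of a] assms(2)[of a] by metis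
    then show "R \<subseteq> Field ?E" by (fastforce simp: Field_def)
  qed
  have reach: "(a, b) \<in> ?E\<^sup>*" if "(a, b) \<in> E\<^sup>*" "a \<in> R" for a b
    using that
  proof (induction rule: rtrancl_induct)
    case (step b c)
    then have "(b, c) \<in> ?E" using closed by auto
    with step show ?case by (meson rtrancl.rtrancl_into_rtrancl)
  qed auto
  have "?E\<inverse> \<subseteq> ?E\<^sup>*"
  proof
    fix x assume "x \<in> ?E\<inverse>"
    then obtain a b where x: "x = (b, a)" "(a, b) \<in> E" "a \<in> R" by auto
    have "b \<in> R" using closed[OF x(3)] x(2) by blast
    moreover have "(b, a) \<in> E\<^sup>*" using x(2,3) unfolding R_def by blast
    ultimately show "x \<in> ?E\<^sup>*" using reach x by blast
  qed
  moreover have "?E `` {a} \<in> act a" if "a \<in> Field ?E" for a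
  proof -
    have "?E `` {a} = E `` {a}" using that Field by auto
    then show ?thesis using assms(1) by simp
  qed
  ultimately show "recurrent_rel act ?E" by (simp add: recurrent_rel_def)
qed

text \<open>Among the reachable nodes, one with the smallest reachable set lies in a final
  class.\<close>

lemma ex_recurrent_reachable:
  fixes E :: "'a::finite rel"
  obtains b where "(a, b) \<in> E\<^sup>*" "\<forall>c. (b, c) \<in> E\<^sup>* \<longrightarrow> (c, b) \<in> E\<^sup>*"
proof -
  obtain b where b: "(a, b) \<in> E\<^sup>*"
    and min: "\<And>c. (a, c) \<in> E\<^sup>* \<Longrightarrow> card (E\<^sup>* `` {b}) \<le> card (E\<^sup>* `` {c})"
    using ex_has_least_nat[of "\<lambda>b. (a, b) \<in> E\<^sup>*" a "\<lambda>b. card (E\<^sup>* `` {b})"] by auto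
  have "(c, b) \<in> E\<^sup>*" if c: "(b, c) \<in> E\<^sup>*" for c
  proof -
    have "E\<^sup>* `` {c} \<subseteq> E\<^sup>* `` {b}" using c by (auto dest: rtrancl_trans)
    moreover have "card (E\<^sup>* `` {b}) \<le> card (E\<^sup>* `` {c})" using min b c rtrancl_trans by metis
    ultimately have "E\<^sup>* `` {c} = E\<^sup>* `` {b}" by (intro card_seteq) auto
    then show ?thesis by auto
  qed
  with b show thesis using that by blast
qed

section \<open>Critical relations of powers\<close>

lemma recurrent_rel_relpow_row:
  assumes "recurrent_rel act E" "a \<in> Field E"
  shows "(E ^^ k) `` {a} \<in> act_power act k a"
  using assms(2)
proof (induction k arbitrary: a)
  case (Suc k)
  have "(E ^^ Suc k) `` {a} = \<Union>((\<lambda>b. (E ^^ k) `` {b}) ` (E `` {a}))"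
    by (auto dest: relpow_Suc_D2 intro: relpow_Suc_I2 simp del: relpow.simps)
  moreover have "E `` {a} \<in> act a" using assms(1) Suc.prems by (simp add: recurrent_rel_def)
  moreover have "\<forall>b\<in>E `` {a}. (E ^^ k) `` {b} \<in> act_power act k b"
    using Suc.IH by (auto simp: Field_def)
  ultimately show ?case unfolding act_power.simps by blast
qed auto

text \<open>A row of the \<open>k\<close>-th power is a tree of choices of height \<open>k\<close>; \<open>T\<close> collects the arcs
  used along it, so that every arc lies on a walk from the root \<open>a\<close> to a leaf in \<open>A\<close>.\<close>

lemma (in action_sets) act_power_tree:
  assumes "A \<in> act_power act k a"
  shows "A \<noteq> {} \<and> (\<exists>T. (\<forall>x\<in>Domain T. T `` {x} \<in> act x) \<and> a \<in> Domain T \<union> A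
    \<and> Range T \<subseteq> Domain T \<union> A
    \<and> (\<forall>(x, y)\<in>T. (a, x) \<in> T\<^sup>* \<and> (\<exists>j\<in>A. (y, j) \<in> T\<^sup>*))
    \<and> (\<forall>j\<in>A. (a, j) \<in> T ^^ k))"
  using assms
proof (induction k arbitrary: A a)
  case 0
  then show ?case by (auto intro!: exI[of _ "{}"])
next
  case (Suc k)
  then obtain B D where B: "B \<in> act a" and D: "\<forall>b\<in>B. D b \<in> act_power act k b"
    and A: "A = \<Union>(D ` B)" by auto
  have Dne: "D b \<noteq> {}" if "b \<in> B" for b
    using Suc.IH[THEN conjunct1, of "D b" b] D that by simp
  have "\<forall>b\<in>B. \<exists>T. (\<forall>x\<in>Domain T. T `` {x} \<in> act x) \<and> b \<in> Domain T \<union> D b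
    \<and> Range T \<subseteq> Domain T \<union> D b
    \<and> (\<forall>(x, y)\<in>T. (b, x) \<in> T\<^sup>* \<and> (\<exists>j\<in>D b. (y, j) \<in> T\<^sup>*))
    \<and> (\<forall>j\<in>D b. (b, j) \<in> T ^^ k)"
    using D by (intro ballI Suc.IH[THEN conjunct2]) simp
  from bchoice[OF this] obtain S where S: "\<forall>b\<in>B. (\<forall>x\<in>Domain (S b). S b `` {x} \<in> act x)
    \<and> b \<in> Domain (S b) \<union> D b \<and> Range (S b) \<subseteq> Domain (S b) \<union> D b
    \<and> (\<forall>(x, y)\<in>S b. (b, x) \<in> (S b)\<^sup>* \<and> (\<exists>j\<in>D b. (y, j) \<in> (S b)\<^sup>*))
    \<and> (\<forall>j\<in>D b. (b, j) \<in> S b ^^ k)" ..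
  have Bne: "B \<noteq> {}" using B empty_notin_act by metis
  define T where "T = {a} \<times> B \<union> (\<Union>b\<in>B. S b)"
  have ST: "S b \<subseteq> T" if "b \<in> B" for b using that by (auto simp: T_def)
  have STr: "x \<in> T\<^sup>*" if "b \<in> B" "x \<in> (S b)\<^sup>*" for b x using ST rtrancl_mono that by blast
  have rows: "T `` {x} \<in> act x" if x: "x \<in> Domain T" for x
  proof -
    \<comment> \<open>The root may recur inside a subtree, and subtrees may share nodes: several
      sets can have been chosen at x, and their union is again allowed.\<close>
    let ?\<A> = "(if x = a then {B} else {}) \<union> (\<lambda>b. S b `` {x}) ` {b\<in>B. x \<in> Domain (S b)}"
    have "T `` {x} = \<Union>?\<A>" by (auto simp: T_def)
    also have "\<dots> \<in> act x"
    proof (rule act_Union)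
      show "?\<A> \<noteq> {}" using x by (auto simp: T_def)
      have "S b `` {x} \<in> act x" if "b \<in> B" "x \<in> Domain (S b)" for b
        using S[rule_format, OF that(1)] that(2) by blast
      then show "?\<A> \<subseteq> act x" using B by (auto split: if_splits simp del: Domain_iff)
    qed
    finally show ?thesis .
  qed
  have root: "a \<in> Domain T \<union> A" using Bne by (auto simp: T_def)
  have range: "Range T \<subseteq> Domain T \<union> A"
  proof -
    have "b \<in> Domain T \<union> A" "Range (S b) \<subseteq> Domain T \<union> A" if "b \<in> B" for b
    proof -
      have "D b \<subseteq> A" using that unfolding A by blast
      moreover have "Domain (S b) \<subseteq> Domain T" by (rule Domain_mono[OF ST[OF that]])
      ultimately show "b \<in> Domain T \<union> A" "Range (S b) \<subseteq> Domain T \<union> A"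
        using S[rule_format, OF that] by blast+
    qed
    note * = this
    show ?thesis
    proof
      fix y assume "y \<in> Range T"
      then consider "y \<in> B" | b where "b \<in> B" "y \<in> Range (S b)" by (auto simp: T_def)
      then show "y \<in> Domain T \<union> A" by cases (use * in blast)+
    qed
  qed
  have leaf: "(a, j) \<in> T ^^ Suc k" if "j \<in> A" for j
  proof -
    obtain b where b: "b \<in> B" "j \<in> D b" using \<open>j \<in> A\<close> A by auto
    then have "(b, j) \<in> S b ^^ k" using S[rule_format, OF b(1)] by blast
    then have "(b, j) \<in> T ^^ k" using relpow_mono[OF ST[OF b(1)]] by blast
    moreover have "(a, b) \<in> T" using b by (auto simp: T_def)
    ultimately show ?thesis by (rule relpow_Suc_I2[rotated])
  qed
  have walk: "(a, x) \<in> T\<^sup>* \<and> (\<exists>j\<in>A. (y, j) \<in> T\<^sup>*)" if xy: "(x, y) \<in> T" for x y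
  proof -
    consider "x = a" "y \<in> B" | b where "b \<in> B" "(x, y) \<in> S b" using xy by (auto simp: T_def)
    then show ?thesis
    proof cases
      case 1
      then obtain j where "j \<in> D y" "(y, j) \<in> (S y) ^^ k"
        using S[rule_format, OF 1(2)] Dne[OF 1(2)] by blast
      then show ?thesis using 1 STr[OF 1(2)] A by (blast dest: relpow_imp_rtrancl)
    next
      case 2
      then have "(b, x) \<in> (S b)\<^sup>* \<and> (\<exists>j\<in>D b. (y, j) \<in> (S b)\<^sup>*)" using S[rule_format, OF 2(1)] by blast
      then have "(b, x) \<in> T\<^sup>* \<and> (\<exists>j\<in>A. (y, j) \<in> T\<^sup>*)" using STr[OF 2(1)] 2(1) A by blast
      moreover have "(a, b) \<in> T" using 2 by (auto simp: T_def)
      ultimately show ?thesis by (meson converse_rtrancl_into_rtrancl)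
    qed
  qed
  obtain b where b: "b \<in> B" using Bne by blast
  then have "D b \<noteq> {}" by (rule Dne)
  then have "A \<noteq> {}" using A b by blast
  show ?case
  proof (intro conjI exI[of _ T])
    show "\<forall>(x, y)\<in>T. (a, x) \<in> T\<^sup>* \<and> (\<exists>j\<in>A. (y, j) \<in> T\<^sup>*)"
    proof
      fix z assume "z \<in> T"
      then show "case z of (x, y) \<Rightarrow> (a, x) \<in> T\<^sup>* \<and> (\<exists>j\<in>A. (y, j) \<in> T\<^sup>*)"
        using walk[of "fst z" "snd z"] by (simp add: case_prod_unfold)
    qed
    show "\<forall>x\<in>Domain T. T `` {x} \<in> act x" using rows by (rule ballI)
    show "\<forall>j\<in>A. (a, j) \<in> T ^^ Suc k" using leaf by (rule ballI)
  qed (fact \<open>A \<noteq> {}\<close> root range)+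
qed

text \<open>For the harder inclusion, the trees behind all rows of a recurrent relation E of the
  power are overlaid to one relation U. It is recurrent for \<open>act\<close>, and each arc of E is
  a k-step walk of U.\<close>

lemma (in action_sets) critical_rel_act_power:
  assumes "k > 0"
  shows "critical_rel (act_power act k) = critical_rel act ^^ k"
proof (rule antisym)
  let ?C = "critical_rel act"
  have "recurrent_rel (act_power act k) (?C ^^ k)"
    unfolding recurrent_rel_def Field_relpow[OF critical_converse assms]
    using recurrent_rel_relpow_row[OF recurrent_critical_rel]
      converse_relpow_subset[OF critical_converse assms] by auto
  then show "?C ^^ k \<subseteq> critical_rel (act_power act k)" by (auto simp: critical_rel_def)
  show "critical_rel (act_power act k) \<subseteq> ?C ^^ k"
    unfolding critical_rel_def[of "act_power act k"]
  proof (rule Union_least)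
    fix E assume "E \<in> {E. recurrent_rel (act_power act k) E}"
    then have row: "\<forall>a\<in>Field E. E `` {a} \<in> act_power act k a" and conv: "E\<inverse> \<subseteq> E\<^sup>*"
      by (auto simp: recurrent_rel_def)
    have "\<forall>a\<in>Field E. \<exists>T. (\<forall>x\<in>Domain T. T `` {x} \<in> act x) \<and> a \<in> Domain T \<union> E `` {a}
      \<and> Range T \<subseteq> Domain T \<union> E `` {a}
      \<and> (\<forall>(x, y)\<in>T. (a, x) \<in> T\<^sup>* \<and> (\<exists>j\<in>E `` {a}. (y, j) \<in> T\<^sup>*))
      \<and> (\<forall>j\<in>E `` {a}. (a, j) \<in> T ^^ k)"
      using row by (intro ballI act_power_tree[THEN conjunct2]) simp
    from bchoice[OF this] obtain S where S: "\<forall>a\<in>Field E. (\<forall>x\<in>Domain (S a). S a `` {x} \<in> act x)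
      \<and> a \<in> Domain (S a) \<union> E `` {a} \<and> Range (S a) \<subseteq> Domain (S a) \<union> E `` {a}
      \<and> (\<forall>(x, y)\<in>S a. (a, x) \<in> (S a)\<^sup>* \<and> (\<exists>j\<in>E `` {a}. (y, j) \<in> (S a)\<^sup>*))
      \<and> (\<forall>j\<in>E `` {a}. (a, j) \<in> S a ^^ k)" ..
    define U where "U = (\<Union>a\<in>Field E. S a)"
    have SU: "S a \<subseteq> U" if "a \<in> Field E" for a using that by (auto simp: U_def)
    have SUr: "x \<in> U\<^sup>*" if "a \<in> Field E" "x \<in> (S a)\<^sup>*" for a x using SU rtrancl_mono that by blast
    have EU: "E \<subseteq> U ^^ k"
    proof
      fix x assume "x \<in> E"
      then obtain a j where aj: "x = (a, j)" "a \<in> Field E" "j \<in> E `` {a}" by (cases x) (auto simp: Field_def)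
      then have "(a, j) \<in> S a ^^ k" using S[rule_format, OF aj(2)] by blast
      then show "x \<in> U ^^ k" using relpow_mono[OF SU[OF aj(2)]] aj by blast
    qed
    have EUr: "E\<^sup>* \<subseteq> U\<^sup>*"
      using rtrancl_mono[OF EU] rtrancl_relpow_subset by blast
    \<comment> \<open>U has no dead ends: a leaf lies in Field E, where a walk of k > 0 steps
      starts.\<close>
    have FE: "Field E \<subseteq> Domain U"
    proof
      fix a assume "a \<in> Field E"
      then have "a \<in> Domain E" using Field_eq_Domain_Range[OF conv] by auto
      then obtain j where "(a, j) \<in> U ^^ k" using EU by auto
      then have "(a, j) \<in> U ^^ Suc (k - 1)" using \<open>k > 0\<close> by simp
      then show "a \<in> Domain U" by (blast dest: relpow_Suc_D2)
    qed
    have "Range U \<subseteq> Domain U"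
    proof
      fix y assume "y \<in> Range U"
      then obtain a where a: "a \<in> Field E" "y \<in> Range (S a)" by (auto simp: U_def)
      then have "y \<in> Domain (S a) \<union> E `` {a}" using S[rule_format, OF a(1)] by blast
      then show "y \<in> Domain U" using FE Domain_mono[OF SU[OF a(1)]] by (auto intro: FieldI2)
    qed
    then have FU: "Field U = Domain U" by (auto simp: Field_def)
    have "recurrent_rel act U"
      unfolding recurrent_rel_def
    proof
      show "\<forall>x\<in>Field U. U `` {x} \<in> act x"
      proof
        fix x assume x: "x \<in> Field U"
        let ?\<A> = "(\<lambda>a. S a `` {x}) ` {a\<in>Field E. x \<in> Domain (S a)}"
        have "U `` {x} = \<Union>?\<A>" by (auto simp: U_def)
        also have "\<dots> \<in> act x"
        proof (rule act_Union)
          show "?\<A> \<noteq> {}" using x unfolding FU by (auto simp: U_def)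
          show "?\<A> \<subseteq> act x" using S by blast
        qed
        finally show "U `` {x} \<in> act x" .
      qed
      show "U\<inverse> \<subseteq> U\<^sup>*"
      proof
        fix z assume "z \<in> U\<inverse>"
        then obtain a x y where z: "z = (y, x)" and a: "a \<in> Field E" "(x, y) \<in> S a"
          by (auto simp: U_def)
        \<comment> \<open>The arc x -> y is returned by y -> j -> a -> x: on to a leaf, back to the
          root along E, and down the tree again.\<close>
        then obtain j where j: "(a, x) \<in> (S a)\<^sup>*" "(a, j) \<in> E" "(y, j) \<in> (S a)\<^sup>*"
          using S[rule_format, OF a(1)] by blast
        then have "(y, j) \<in> U\<^sup>*" "(a, x) \<in> U\<^sup>*" using SUr[OF a(1)] by auto
        moreover have "(j, a) \<in> U\<^sup>*" using conv EUr j(2) by blast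
        ultimately show "z \<in> U\<^sup>*" using z by (meson rtrancl_trans)
      qed
    qed
    then show "E \<subseteq> ?C ^^ k" using EU relpow_mono[OF critical_rel_upper] by blast
  qed
qed

section \<open>Subgradients and their supports\<close>

definition subgrad :: "(real ^ 'n \<Rightarrow> real ^ 'n) \<Rightarrow> real ^ 'n \<Rightarrow> 'n \<Rightarrow> (real ^ 'n) set" where
  "subgrad g v i = {p. \<forall>x. g x $ i - g v $ i \<ge> p \<bullet> (x - v)}"

definition supp :: "real ^ 'n \<Rightarrow> 'n set" where
  "supp p = {j. p $ j \<noteq> 0}"

definition subgrad_supports :: "(real ^ 'n \<Rightarrow> real ^ 'n) \<Rightarrow> real ^ 'n \<Rightarrow> 'n \<Rightarrow> 'n set set" where
  "subgrad_supports g v i = supp ` subgrad g v i"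

lemma inner_vec_real: "(p :: real ^ 'n) \<bullet> x = (\<Sum>j\<in>UNIV. p $ j * x $ j)"
  by (simp add: inner_vec_def)

text \<open>The product structure that allows rows to be chosen independently at each node.\<close>

lemma subdifferential_iff: "P \<in> subdifferential g v \<longleftrightarrow> (\<forall>i. P $ i \<in> subgrad g v i)"
  unfolding subdifferential_def subgrad_def less_eq_vec_def
  by (auto simp: matrix_vector_mul_component)

text \<open>A hyperplane separates the point (v, phi(v)) from the strict epigraph, which misses it.
  Its normal (q, t) has t > 0, and - q / t is the slope.\<close>

lemma convex_on_subgradient:
  fixes \<phi> :: "'a::euclidean_space \<Rightarrow> real"
  assumes "convex_on UNIV \<phi>"
  obtains p where "\<And>x. \<phi> x - \<phi> v \<ge> p \<bullet> (x - v)"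
proof -
  let ?T = "{(x, r). \<phi> x < r}"
  have "convex ?T"
  proof (rule convexI)
    fix z w :: "'a \<times> real" and a b :: real
    assume "z \<in> ?T" "w \<in> ?T" and ab: "0 \<le> a" "0 \<le> b" "a + b = 1"
    then obtain x r y s where zw: "z = (x, r)" "w = (y, s)" "\<phi> x < r" "\<phi> y < s" by auto
    have "\<phi> (a *\<^sub>R x + b *\<^sub>R y) \<le> a * \<phi> x + b * \<phi> y"
      using assms ab by (simp add: convex_on_def)
    also have "\<dots> < a * r + b * s"
    proof (cases "a = 0")
      case False
      then have "a * \<phi> x < a * r" using zw ab by simp
      moreover have "b * \<phi> y \<le> b * s" using zw ab by (simp add: mult_left_mono)
      ultimately show ?thesis by linarith
    qed (use zw ab in auto)
    finally show "a *\<^sub>R z + b *\<^sub>R w \<in> ?T" by (simp add: zw)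
  qed
  moreover have "?T \<noteq> {}" using lt_ex[of "\<phi> v"] by (auto intro!: exI[of _ v] gt_ex)
  ultimately obtain c b where c: "c \<noteq> 0" "c \<bullet> (v, \<phi> v) \<le> b" "\<And>z. z \<in> ?T \<Longrightarrow> c \<bullet> z \<ge> b"
    using separating_hyperplane_sets[of "{(v, \<phi> v)}" ?T] by auto
  obtain q t where qt: "c = (q, t)" by (cases c)
  have le: "q \<bullet> v + t * \<phi> v \<le> q \<bullet> x + t * r" if "\<phi> x < r" for x r
    using c(2) c(3)[of "(x, r)"] that by (simp add: qt inner_prod_def)
  have "t * \<phi> v \<le> t * (\<phi> v + 1)" using le[of v "\<phi> v + 1"] by simp
  then have "t \<ge> 0" by (simp add: algebra_simps)
  moreover have "t \<noteq> 0"
  proof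
    assume "t = 0"
    \<comment> \<open>A vertical hyperplane is refuted by moving from v against its normal.\<close>
    then have "q \<bullet> v \<le> q \<bullet> (v - q)" using le[of "v - q" "\<phi> (v - q) + 1"] by simp
    then have "q \<bullet> q \<le> 0" by (simp add: inner_diff_right)
    then have "q = 0" by (meson inner_gt_zero_iff not_le)
    then show False using c(1) qt \<open>t = 0\<close> by (simp add: zero_prod_def)
  qed
  ultimately have t: "t > 0" by simp
  have "\<phi> x - \<phi> v \<ge> (- (1 / t) *\<^sub>R q) \<bullet> (x - v)" for x
  proof -
    \<comment> \<open>Separation only covers heights r > phi(x); the height phi(x) is reached in the
      limit.\<close>
    have "q \<bullet> v + t * \<phi> v \<le> q \<bullet> x + t * \<phi> x"
    proof (rule field_le_epsilon)
      fix e :: real assume "e > 0"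
      then show "q \<bullet> v + t * \<phi> v \<le> q \<bullet> x + t * \<phi> x + e"
        using le[of x "\<phi> x + e / t"] t by (simp add: algebra_simps)
    qed
    then show ?thesis using t by (simp add: inner_diff_right field_simps)
  qed
  then show thesis by (rule that)
qed

text \<open>Minimum principle: an average not exceeding a lower bound of the averaged entries leaves
  no slack at any charged entry.\<close>

lemma average_eq_min:
  fixes p u :: "real ^ 'n"
  assumes "\<And>j. p $ j \<ge> 0" "sum (($) p) UNIV = 1"
    and min: "\<And>j. j \<in> supp p \<Longrightarrow> u $ j \<ge> M" and "p \<bullet> u \<le> M" and "j \<in> supp p"
  shows "u $ j = M"
proof -
  have nonneg: "p $ j * (u $ j - M) \<ge> 0" for j
    using assms(1)[of j] min[of j] by (cases "p $ j = 0") (auto simp: supp_def)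
  have "(\<Sum>j\<in>UNIV. p $ j * (u $ j - M)) = p \<bullet> u - M"
    using assms(2) by (simp add: inner_vec_real right_diff_distrib sum_subtractf flip: sum_distrib_right)
  then have "(\<Sum>j\<in>UNIV. p $ j * (u $ j - M)) = 0"
    using \<open>p \<bullet> u \<le> M\<close> nonneg by (intro antisym sum_nonneg) auto
  then have "p $ j * (u $ j - M) = 0"
    using nonneg by (subst (asm) sum_nonneg_eq_0_iff) auto
  then show ?thesis using \<open>j \<in> supp p\<close> by (simp add: supp_def)
qed

lemma average_const:
  fixes p u :: "real ^ 'n"
  assumes "sum (($) p) UNIV = 1" "\<And>j. j \<in> supp p \<Longrightarrow> u $ j = M"
  shows "p \<bullet> u = M"
proof -
  have "p \<bullet> u = (\<Sum>j\<in>UNIV. p $ j * M)"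
    unfolding inner_vec_real using assms(2) by (intro sum.cong) (auto simp: supp_def)
  then show ?thesis using assms(1) by (simp flip: sum_distrib_right)
qed

section \<open>Convex monotone homogeneous maps and their stochastic subgradients\<close>

locale convex_monotone_map =
  fixes f :: "real ^ 'n \<Rightarrow> real ^ 'n"
  assumes convex: "coordinatewise_convex f" and mono: "mono f"
    and homogeneous: "additively_homogeneous f"
begin

lemma le_shift:
  assumes "\<And>i. x $ i \<le> y $ i + d"
  shows "f x $ i \<le> f y $ i + d"
proof -
  have "x \<le> vec d + y" using assms by (simp add: less_eq_vec_def add.commute)
  then have "f x \<le> f (vec d + y)" by (rule monoD[OF mono])
  also have "\<dots> = vec d + f y" using homogeneous by (simp add: additively_homogeneous_def)
  finally show ?thesis by (simp add: less_eq_vec_def add.commute)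
qed

text \<open>The map is nonexpansive in the sup norm; the Euclidean norm dominates it and is the one
  in which limits are taken.\<close>

lemma nonexpansive: "\<bar>f x $ i - f y $ i\<bar> \<le> norm (x - y)"
proof -
  have *: "x $ i - y $ i \<le> norm (x - y)" "y $ i - x $ i \<le> norm (x - y)" for i
    using component_le_norm_cart[of "x - y" i] by auto
  have "f x $ i \<le> f y $ i + norm (x - y)" using * by (intro le_shift) (simp add: algebra_simps)
  moreover have "f y $ i \<le> f x $ i + norm (x - y)"
    using * by (intro le_shift) (simp add: algebra_simps)
  ultimately show ?thesis by linarith
qed

lemma tendsto_map:
  assumes "(X \<longlongrightarrow> x) F"
  shows "((\<lambda>n. f (X n)) \<longlongrightarrow> f x) F"
proof (rule vec_tendstoI)
  fix i
  have "((\<lambda>n. norm (X n - x)) \<longlongrightarrow> 0) F"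
    using assms by (simp add: tendsto_norm_zero_iff Lim_null[symmetric])
  then have "((\<lambda>n. f (X n) $ i - f x $ i) \<longlongrightarrow> 0) F"
    by (rule Lim_null_comparison[rotated]) (simp add: nonexpansive)
  then show "((\<lambda>n. f (X n) $ i) \<longlongrightarrow> f x $ i) F" by (simp add: Lim_null[symmetric])
qed

lemma subgrad_nonneg:
  assumes "p \<in> subgrad f v i"
  shows "p $ j \<ge> 0"
proof -
  have "p \<bullet> ((v - axis j 1) - v) \<le> f (v - axis j 1) $ i - f v $ i"
    using assms unfolding subgrad_def by blast
  also have "\<dots> \<le> 0"
  proof -
    have "v - axis j 1 \<le> v" by (simp add: less_eq_vec_def axis_def)
    then have "f (v - axis j 1) \<le> f v" by (rule monoD[OF mono])
    then show ?thesis by (simp add: less_eq_vec_def)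
  qed
  finally show ?thesis by (simp add: cart_eq_inner_axis)
qed

text \<open>Along the all-ones direction f grows by exactly t; t = 1 and t = -1 give the two
  inequalities.\<close>

lemma subgrad_sum:
  assumes "p \<in> subgrad f v i"
  shows "sum (($) p) UNIV = 1"
proof -
  have "t * sum (($) p) UNIV \<le> t" for t
  proof -
    have "p \<bullet> (vec t + v - v) \<le> f (vec t + v) $ i - f v $ i"
      using assms by (simp only: subgrad_def mem_Collect_eq)
    then show ?thesis
      using homogeneous
      by (simp add: additively_homogeneous_def inner_vec_real mult.commute[of t] sum_distrib_right)
  qed
  from this[of 1] this[of "- 1"] show ?thesis by simp
qed

lemma supp_subgrad_nonempty:
  assumes "p \<in> subgrad f v i"
  shows "supp p \<noteq> {}"
proof
  assume "supp p = {}"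
  then have "sum (($) p) UNIV = 0" by (intro sum.neutral) (auto simp: supp_def)
  then show False using subgrad_sum[OF assms] by simp
qed

lemma subgrad_nonempty: "\<exists>p. p \<in> subgrad f v i"
  using convex convex_on_subgradient[of "\<lambda>x. f x $ i" v]
  unfolding coordinatewise_convex_def subgrad_def by blast

lemma subdifferential_nonempty: "\<exists>P. P \<in> subdifferential f v"
proof -
  obtain p where "\<And>i. p i \<in> subgrad f v i" using subgrad_nonempty by metis
  then have "(\<chi> i. p i) \<in> subdifferential f v" by (simp add: subdifferential_iff)
  then show ?thesis ..
qed

lemma action_sets_subgrad_supports: "action_sets (subgrad_supports f v)"
proof
  show "subgrad_supports f v a \<noteq> {}" for a
    using subgrad_nonempty[of v a] by (auto simp: subgrad_supports_def)
  show "{} \<notin> subgrad_supports f v a" for a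
    using supp_subgrad_nonempty by (auto simp: subgrad_supports_def)
  fix A B a assume "A \<in> subgrad_supports f v a" "B \<in> subgrad_supports f v a"
  then obtain p q where pq: "p \<in> subgrad f v a" "A = supp p" "q \<in> subgrad f v a" "B = supp q"
    by (auto simp: subgrad_supports_def)
  \<comment> \<open>The midpoint is again a subgradient, and nonnegative entries cannot
    cancel.\<close>
  let ?r = "(1 / 2) *\<^sub>R (p + q)"
  have "?r \<bullet> (x - v) \<le> f x $ a - f v $ a" for x
  proof -
    have "p \<bullet> (x - v) \<le> f x $ a - f v $ a" "q \<bullet> (x - v) \<le> f x $ a - f v $ a"
      using pq by (auto simp: subgrad_def)
    then show ?thesis by (simp add: inner_add_left)
  qed
  then have "?r \<in> subgrad f v a" by (simp add: subgrad_def)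
  moreover have "supp ?r = A \<union> B"
    using pq subgrad_nonneg[OF pq(1)] subgrad_nonneg[OF pq(3)]
    by (auto simp: supp_def add_nonneg_eq_0_iff)
  ultimately show "A \<union> B \<in> subgrad_supports f v a" by (auto simp: subgrad_supports_def)
qed

text \<open>Stochastic matrices have entries in [0, 1], which gives compactness; the subgradient
  inequality survives the limit by continuity of f.\<close>

lemma subdifferential_seq_limit:
  assumes "X \<longlonglongrightarrow> x" "\<And>n. P n \<in> subdifferential f (X n)"
  obtains r Q where "strict_mono (r :: nat \<Rightarrow> nat)" "(P \<circ> r) \<longlonglongrightarrow> Q" "Q \<in> subdifferential f x"
proof -
  have row: "P n $ i \<in> subgrad f (X n) i" for n i using assms(2) by (simp add: subdifferential_iff)
  have entry: "0 \<le> P n $ i $ j \<and> P n $ i $ j \<le> 1" for n i j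
  proof -
    have "P n $ i $ j \<le> sum (($) (P n $ i)) UNIV"
      using subgrad_nonneg[OF row] by (intro member_le_sum) auto
    then show ?thesis using subgrad_nonneg[OF row] subgrad_sum[OF row] by simp
  qed
  have "compact {0 .. (1 :: real ^ 'n ^ 'n)}" by (simp add: compact_cbox flip: cbox_interval)
  moreover have "\<forall>n. P n \<in> {0 .. 1}"
    using entry by (simp add: less_eq_vec_def)
  ultimately obtain Q r where r: "strict_mono (r :: nat \<Rightarrow> nat)" "(P \<circ> r) \<longlonglongrightarrow> Q"
    unfolding compact_eq_seq_compact_metric using seq_compactE[of "{0..1}" P] by blast
  have X: "(X \<circ> r) \<longlonglongrightarrow> x" by (rule LIMSEQ_subseq_LIMSEQ[OF assms(1) r(1)])
  have "Q $ i \<bullet> (y - x) \<le> f y $ i - f x $ i" for i y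
  proof (rule LIMSEQ_le)
    show "(\<lambda>n. (P \<circ> r) n $ i \<bullet> (y - (X \<circ> r) n)) \<longlonglongrightarrow> Q $ i \<bullet> (y - x)"
      by (intro tendsto_inner tendsto_vec_nth r tendsto_diff X tendsto_const)
    show "(\<lambda>n. f y $ i - f ((X \<circ> r) n) $ i) \<longlonglongrightarrow> f y $ i - f x $ i"
      by (intro tendsto_vec_nth tendsto_diff tendsto_map X tendsto_const)
    show "\<exists>N. \<forall>n\<ge>N. (P \<circ> r) n $ i \<bullet> (y - (X \<circ> r) n) \<le> f y $ i - f ((X \<circ> r) n) $ i"
      using row by (auto simp: subgrad_def)
  qed
  then have "Q \<in> subdifferential f x" by (simp add: subdifferential_iff subgrad_def)
  with r show thesis by (rule that)
qed

end

section \<open>Chain rule for supports\<close>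

lemma supp_vector_matrix_mult:
  fixes q :: "real ^ 'n" and Q :: "real ^ 'm ^ 'n"
  assumes "\<And>b. q $ b \<ge> 0" "\<And>b j. Q $ b $ j \<ge> 0"
  shows "supp (q v* Q) = (\<Union>b\<in>supp q. supp (Q $ b))"
  using assms by (auto simp: supp_def vector_matrix_mult_def sum_nonneg_eq_0_iff)

text \<open>Convexity of the composition uses monotonicity of the outer map, which carries the
  convexity inequality of g through f.\<close>

lemma convex_monotone_map_comp:
  assumes "convex_monotone_map f" "convex_monotone_map g"
  shows "convex_monotone_map (f \<circ> g)"
proof
  interpret f: convex_monotone_map f by fact
  interpret g: convex_monotone_map g by fact
  show "mono (f \<circ> g)" using f.mono g.mono by (simp add: mono_def)
  show "additively_homogeneous (f \<circ> g)"
    using f.homogeneous g.homogeneous by (simp add: additively_homogeneous_def)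
  show "coordinatewise_convex (f \<circ> g)"
    unfolding coordinatewise_convex_def
  proof (intro allI convex_onI)
    fix i t x y assume t: "0 < (t::real)" "t < 1"
    have "g ((1 - t) *\<^sub>R x + t *\<^sub>R y) $ j \<le> ((1 - t) *\<^sub>R g x + t *\<^sub>R g y) $ j" for j
      using convex_onD[of UNIV "\<lambda>x. g x $ j" t x y] g.convex t
      by (simp add: coordinatewise_convex_def)
    then have "g ((1 - t) *\<^sub>R x + t *\<^sub>R y) \<le> (1 - t) *\<^sub>R g x + t *\<^sub>R g y"
      by (simp add: less_eq_vec_def)
    then have "f (g ((1 - t) *\<^sub>R x + t *\<^sub>R y)) \<le> f ((1 - t) *\<^sub>R g x + t *\<^sub>R g y)"
      by (rule monoD[OF f.mono])
    then have "f (g ((1 - t) *\<^sub>R x + t *\<^sub>R y)) $ i \<le> f ((1 - t) *\<^sub>R g x + t *\<^sub>R g y) $ i"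
      by (simp add: less_eq_vec_def)
    also have "\<dots> \<le> (1 - t) * f (g x) $ i + t * f (g y) $ i"
      using convex_onD[of UNIV "\<lambda>x. f x $ i" t "g x" "g y"] f.convex t
      by (simp add: coordinatewise_convex_def)
    finally show "(f \<circ> g) ((1 - t) *\<^sub>R x + t *\<^sub>R y) $ i
        \<le> (1 - t) * (f \<circ> g) x $ i + t * (f \<circ> g) y $ i" by simp
  qed simp
qed

lemma convex_monotone_map_id: "convex_monotone_map id"
  by standard (auto simp: coordinatewise_convex_def additively_homogeneous_def mono_def
      intro!: convex_onI)

lemma convex_monotone_map_funpow:
  assumes "convex_monotone_map f"
  shows "convex_monotone_map (f ^^ k)"
proof (induction k)
  case 0
  show ?case using convex_monotone_map_id by (simp add: id_def)
next
  case (Suc k)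
  show ?case using convex_monotone_map_comp[OF assms Suc] by (simp add: o_def)
qed

text \<open>The elementary half of the chain rule: q is nonnegative, so averaging by q preserves the
  subgradient inequality of g.\<close>

lemma subgrad_comp:
  assumes "convex_monotone_map f" "q \<in> subgrad f (g v) i" "Q \<in> subdifferential g v"
  shows "q v* Q \<in> subgrad (f \<circ> g) v i"
proof -
  interpret convex_monotone_map f by fact
  have "(q v* Q) \<bullet> (x - v) \<le> f (g x) $ i - f (g v) $ i" for x
  proof -
    have "(q v* Q) \<bullet> (x - v) = q \<bullet> (Q *v (x - v))" by (rule dot_lmul_matrix)
    also have "\<dots> \<le> q \<bullet> (g x - g v)"
      unfolding inner_vec_real using assms(3) subgrad_nonneg[OF assms(2)]
      by (intro sum_mono mult_left_mono) (auto simp: subdifferential_def less_eq_vec_def)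
    also have "\<dots> \<le> f (g x) $ i - f (g v) $ i" using assms(2) by (simp add: subgrad_def)
    finally show ?thesis .
  qed
  then show ?thesis by (simp add: subgrad_def)
qed

text \<open>Subgradients of \<open>f \<circ> g\<close> at points \<open>v + \<epsilon> d\<close> factor through subgradients of \<open>f\<close> and \<open>g\<close>
  by \<open>subgrad_comp\<close>, and by monotonicity of the subdifferential they dominate \<open>p\<close> in the
  direction \<open>d\<close>. The direction \<open>d = e\<^sub>j - n 1\<^bsub>- supp p\<^esub>\<close> with \<open>n \<rightarrow> \<infinity>\<close> forces the limit to
  charge \<open>j\<close> and to vanish outside \<open>supp p\<close>.\<close>

lemma subgrad_comp_support:
  assumes f: "convex_monotone_map f" and g: "convex_monotone_map g"
    and p: "p \<in> subgrad (f \<circ> g) v i" and j: "j \<in> supp p"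
  obtains q Q where "q \<in> subgrad f (g v) i" "Q \<in> subdifferential g v"
    "j \<in> supp (q v* Q)" "supp (q v* Q) \<subseteq> supp p"
proof -
  interpret f: convex_monotone_map f by fact
  interpret g: convex_monotone_map g by fact
  interpret fg: convex_monotone_map "f \<circ> g" by (rule convex_monotone_map_comp[OF f g])
  define d :: "nat \<Rightarrow> real ^ 'a" where
    "d n = (\<chi> m. if m = j then 1 else if m \<in> supp p then 0 else - real n)" for n
  \<comment> \<open>The entries of \<open>d n\<close> grow like n; the factor 1 / (n + 1)^2 still
    sends the displacement to 0.\<close>
  define \<epsilon> :: "nat \<Rightarrow> real" where "\<epsilon> n = inverse (real (Suc n)) * inverse (real (Suc n))" for n
  define x where "x n = v + \<epsilon> n *\<^sub>R d n" for n
  have \<epsilon>: "\<epsilon> n > 0" for n by (simp add: \<epsilon>_def)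
  have inner_d: "r \<bullet> d n = r $ j - real n * (\<Sum>m\<in>- supp p. r $ m)" for r n
  proof -
    have "r \<bullet> d n = (\<Sum>m\<in>supp p \<union> - supp p. r $ m * d n $ m)" by (simp add: inner_vec_real)
    also have "\<dots> = (\<Sum>m\<in>supp p. r $ m * d n $ m) + (\<Sum>m\<in>- supp p. r $ m * d n $ m)"
      by (rule sum.union_disjoint) auto
    also have "(\<Sum>m\<in>supp p. r $ m * d n $ m) = (\<Sum>m\<in>supp p. if m = j then r $ m else 0)"
      by (intro sum.cong) (auto simp: d_def)
    also have "\<dots> = r $ j" using j by simp
    also have "(\<Sum>m\<in>- supp p. r $ m * d n $ m) = (\<Sum>m\<in>- supp p. - real n * r $ m)"
      using j by (intro sum.cong) (auto simp: d_def)
    finally show ?thesis by (simp add: sum_distrib_left sum_negf)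
  qed
  have x: "x \<longlonglongrightarrow> v"
  proof -
    have lim: "(\<lambda>n. inverse (real (Suc n))) \<longlonglongrightarrow> 0" by (rule LIMSEQ_inverse_real_of_nat)
    have "(\<lambda>n. \<epsilon> n * d n $ m) \<longlonglongrightarrow> 0" for m
    proof (rule Lim_null_comparison[OF _ lim])
      have "\<bar>d n $ m\<bar> \<le> real (Suc n)" for n by (simp add: d_def)
      then have "\<epsilon> n * \<bar>d n $ m\<bar> \<le> \<epsilon> n * real (Suc n)" for n
        using \<epsilon>[of n] by (intro mult_left_mono) auto
      also have "\<epsilon> n * real (Suc n) = inverse (real (Suc n))" for n
        by (simp add: \<epsilon>_def)
      finally show "\<forall>\<^sub>F n in sequentially. norm (\<epsilon> n * d n $ m) \<le> inverse (real (Suc n))"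
        using \<epsilon> by (simp add: abs_mult less_imp_le)
    qed
    then have "(\<lambda>n. v $ m + \<epsilon> n * d n $ m) \<longlonglongrightarrow> v $ m + 0" for m
      by (intro tendsto_add tendsto_const)
    then show ?thesis by (intro vec_tendstoI) (simp add: x_def)
  qed
  obtain A where A: "\<And>n. A n \<in> subdifferential f (g (x n))"
    using f.subdifferential_nonempty choice[of "\<lambda>n A. A \<in> subdifferential f (g (x n))"] by blast
  obtain B where B: "\<And>n. B n \<in> subdifferential g (x n)"
    using g.subdifferential_nonempty choice[of "\<lambda>n A. A \<in> subdifferential g (x n)"] by blast
  obtain r A' where r: "strict_mono (r :: nat \<Rightarrow> nat)" "(A \<circ> r) \<longlonglongrightarrow> A'" "A' \<in> subdifferential f (g v)"
    using f.subdifferential_seq_limit[OF g.tendsto_map[OF x] A] .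
  \<comment> \<open>The second extraction runs inside the first, so that both factors converge along
    a common subsequence.\<close>
  obtain s B' where s: "strict_mono (s :: nat \<Rightarrow> nat)" "((B \<circ> r) \<circ> s) \<longlonglongrightarrow> B'" "B' \<in> subdifferential g v"
    using g.subdifferential_seq_limit[OF LIMSEQ_subseq_LIMSEQ[OF x r(1)], of "B \<circ> r"] B by auto
  define t where "t = r \<circ> s"
  have t: "strict_mono t" unfolding t_def by (rule strict_mono_o[OF r(1) s(1)])
  have A': "(\<lambda>n. A (t n)) \<longlonglongrightarrow> A'"
    using LIMSEQ_subseq_LIMSEQ[OF r(2) s(1)] by (simp add: t_def o_def)
  have B': "(\<lambda>n. B (t n)) \<longlonglongrightarrow> B'" using s(2) by (simp add: t_def o_def)
  define R where "R n = A n $ i v* B n" for n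
  define R' where "R' = A' $ i v* B'"
  have lim: "(\<lambda>n. R (t n) $ m) \<longlonglongrightarrow> R' $ m" for m
    unfolding R_def R'_def vector_matrix_mult_def vec_lambda_beta
    by (intro tendsto_sum tendsto_mult tendsto_vec_nth A' B')
  have RS: "R n \<in> subgrad (f \<circ> g) (x n) i" for n
    unfolding R_def using A B by (intro subgrad_comp f) (auto simp: subdifferential_iff)
  have "R n \<bullet> d n \<ge> p $ j" for n
  proof -
    have "p \<bullet> (x n - v) \<le> (f \<circ> g) (x n) $ i - (f \<circ> g) v $ i"
      using p by (simp add: subgrad_def)
    moreover have "R n \<bullet> (v - x n) \<le> (f \<circ> g) v $ i - (f \<circ> g) (x n) $ i"
      using RS[of n] by (simp only: subgrad_def mem_Collect_eq)
    ultimately have "\<epsilon> n * (p \<bullet> d n) \<le> \<epsilon> n * (R n \<bullet> d n)" by (simp add: x_def)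
    then have "p \<bullet> d n \<le> R n \<bullet> d n" using \<epsilon> by simp
    moreover have "(\<Sum>m\<in>- supp p. p $ m) = 0" by (intro sum.neutral) (auto simp: supp_def)
    ultimately show ?thesis by (simp add: inner_d)
  qed
  \<comment> \<open>Since \<open>R n $ j\<close> is at most 1, the mass of \<open>R n\<close>
    outside \<open>supp p\<close> is of order 1 / n, while entry j keeps at least
    \<open>p $ j\<close>.\<close>
  then have main: "R n $ j \<ge> p $ j + real n * (\<Sum>m\<in>- supp p. R n $ m)" for n
    by (simp add: inner_d algebra_simps)
  have sum0: "(\<Sum>m\<in>- supp p. R n $ m) \<ge> 0" for n
    by (intro sum_nonneg fg.subgrad_nonneg[OF RS])
  have le1: "R n $ j \<le> 1" for n
  proof -
    have "R n $ j \<le> sum (($) (R n)) UNIV"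
      using fg.subgrad_nonneg[OF RS] by (intro member_le_sum) auto
    then show ?thesis using fg.subgrad_sum[OF RS] by simp
  qed
  have pj: "p $ j > 0" using j fg.subgrad_nonneg[OF p, of j] by (simp add: supp_def)
  have "R' $ j \<ge> p $ j"
  proof (rule LIMSEQ_le_const[OF lim])
    show "\<exists>N. \<forall>n\<ge>N. p $ j \<le> R (t n) $ j"
    proof (intro exI allI impI)
      fix n
      have "real (t n) * (\<Sum>m\<in>- supp p. R (t n) $ m) \<ge> 0" using sum0 by simp
      then show "p $ j \<le> R (t n) $ j" using main[of "t n"] by linarith
    qed
  qed
  then have "j \<in> supp R'" using pj by (simp add: supp_def)
  moreover have "R' $ m = 0" if m: "m \<in> - supp p" for m
  proof -
    have "R (Suc n) $ m \<le> inverse (real (Suc n))" for n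
    proof -
      have "R (Suc n) $ m \<le> (\<Sum>m\<in>- supp p. R (Suc n) $ m)"
        using m fg.subgrad_nonneg[OF RS] by (intro member_le_sum) auto
      then have "real (Suc n) * R (Suc n) $ m \<le> real (Suc n) * (\<Sum>m\<in>- supp p. R (Suc n) $ m)"
        by (intro mult_left_mono) auto
      also have "\<dots> \<le> 1" using main[of "Suc n"] le1[of "Suc n"] pj by linarith
      finally show ?thesis by (simp add: field_simps)
    qed
    then have "(\<lambda>n. R (Suc n) $ m) \<longlonglongrightarrow> 0"
      using fg.subgrad_nonneg[OF RS]
      by (intro Lim_null_comparison[OF _ LIMSEQ_inverse_real_of_nat]) auto
    then have "(\<lambda>n. R n $ m) \<longlonglongrightarrow> 0" by (rule LIMSEQ_imp_Suc)
    then have "(\<lambda>n. R (t n) $ m) \<longlonglongrightarrow> 0"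
      using LIMSEQ_subseq_LIMSEQ[OF _ t, of "\<lambda>n. R n $ m"] by (simp add: o_def)
    then show ?thesis using lim LIMSEQ_unique by blast
  qed
  then have "supp R' \<subseteq> supp p" by (auto simp: supp_def)
  ultimately show thesis
    using that[of "A' $ i" B'] r(3) s(3) by (auto simp: R'_def subdifferential_iff)
qed

text \<open>For the inclusion from left to right, each j in the support A has its own factorisation
  that charges j and stays inside A; all of them are merged.\<close>

lemma subgrad_supports_comp:
  assumes f: "convex_monotone_map f" and g: "convex_monotone_map g"
  shows "subgrad_supports (f \<circ> g) v i =
    {\<Union>(D ` B) | B D. B \<in> subgrad_supports f (g v) i \<and> (\<forall>b\<in>B. D b \<in> subgrad_supports g v b)}"
    (is "_ = ?rhs")
proof (intro equalityI subsetI)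
  interpret f: convex_monotone_map f by fact
  interpret g: convex_monotone_map g by fact
  interpret fg: convex_monotone_map "f \<circ> g" by (rule convex_monotone_map_comp[OF f g])
  interpret fa: action_sets "subgrad_supports f (g v)" by (rule f.action_sets_subgrad_supports)
  interpret ga: action_sets "subgrad_supports g v" by (rule g.action_sets_subgrad_supports)
  have supp_prod: "supp (q v* Q) = (\<Union>b\<in>supp q. supp (Q $ b))"
    if "q \<in> subgrad f (g v) i" "Q \<in> subdifferential g v" for q Q
  proof (rule supp_vector_matrix_mult)
    show "q $ b \<ge> 0" for b by (rule f.subgrad_nonneg[OF that(1)])
    show "Q $ b $ j \<ge> 0" for b j
      using that(2) by (intro g.subgrad_nonneg[of _ v b]) (simp add: subdifferential_iff)
  qed
  {
    fix A assume "A \<in> ?rhs"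
    then obtain q D where q: "q \<in> subgrad f (g v) i" and A: "A = \<Union>(D ` supp q)"
      and D: "\<forall>b\<in>supp q. D b \<in> subgrad_supports g v b"
      by (auto simp: subgrad_supports_def)
    \<comment> \<open>Rows outside \<open>supp q\<close> do not enter the product, so any
      subgradient fills them.\<close>
    have "\<forall>b. \<exists>p. p \<in> subgrad g v b \<and> (b \<in> supp q \<longrightarrow> supp p = D b)"
    proof
      fix b show "\<exists>p. p \<in> subgrad g v b \<and> (b \<in> supp q \<longrightarrow> supp p = D b)"
      proof (cases "b \<in> supp q")
        case True
        then have "D b \<in> supp ` subgrad g v b" using D by (simp add: subgrad_supports_def)
        then show ?thesis by blast
      qed (use g.subgrad_nonempty[of v b] in auto)
    qed
    then obtain P where P: "\<And>b. P b \<in> subgrad g v b" "\<And>b. b \<in> supp q \<Longrightarrow> supp (P b) = D b"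
      by metis
    let ?Q = "\<chi> b. P b"
    have Q: "?Q \<in> subdifferential g v" using P by (simp add: subdifferential_iff)
    have "supp (q v* ?Q) = A" unfolding supp_prod[OF q Q] A using P by auto
    then show "A \<in> subgrad_supports (f \<circ> g) v i"
      using subgrad_comp[OF f q Q] by (auto simp: subgrad_supports_def)
  next
    fix A assume "A \<in> subgrad_supports (f \<circ> g) v i"
    then obtain p where p: "p \<in> subgrad (f \<circ> g) v i" and A: "A = supp p"
      by (auto simp: subgrad_supports_def)
    have "\<forall>j\<in>A. \<exists>q Q. q \<in> subgrad f (g v) i \<and> Q \<in> subdifferential g v
        \<and> j \<in> supp (q v* Q) \<and> supp (q v* Q) \<subseteq> A"
    proof
      fix j assume "j \<in> A"
      then have "j \<in> supp p" by (simp add: A)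
      then obtain q Q where "q \<in> subgrad f (g v) i" "Q \<in> subdifferential g v"
        "j \<in> supp (q v* Q)" "supp (q v* Q) \<subseteq> supp p"
        by (rule subgrad_comp_support[OF f g p])
      then show "\<exists>q Q. q \<in> subgrad f (g v) i \<and> Q \<in> subdifferential g v
          \<and> j \<in> supp (q v* Q) \<and> supp (q v* Q) \<subseteq> A"
        unfolding A by (intro exI conjI)
    qed
    from bchoice[OF this] obtain q where
      "\<forall>j\<in>A. \<exists>Q. q j \<in> subgrad f (g v) i \<and> Q \<in> subdifferential g v
        \<and> j \<in> supp (q j v* Q) \<and> supp (q j v* Q) \<subseteq> A" ..
    from bchoice[OF this] obtain Q where
      "\<forall>j\<in>A. q j \<in> subgrad f (g v) i \<and> Q j \<in> subdifferential g v
        \<and> j \<in> supp (q j v* Q j) \<and> supp (q j v* Q j) \<subseteq> A" ..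
    then have q: "\<And>j. j \<in> A \<Longrightarrow> q j \<in> subgrad f (g v) i"
      and Q: "\<And>j. j \<in> A \<Longrightarrow> Q j \<in> subdifferential g v"
      and j: "\<And>j. j \<in> A \<Longrightarrow> j \<in> supp (q j v* Q j)"
      and sub: "\<And>j. j \<in> A \<Longrightarrow> supp (q j v* Q j) \<subseteq> A"
      by simp_all
    define B where "B = (\<Union>j\<in>A. supp (q j))"
    \<comment> \<open>Only factorisations whose outer part charges b are merged here: row b of the
      others may leave A.\<close>
    define D where "D b = (\<Union>j\<in>{j\<in>A. b \<in> supp (q j)}. supp (Q j $ b))" for b
    have "A \<noteq> {}" using fg.supp_subgrad_nonempty[OF p] A by simp
    then have "B \<in> subgrad_supports f (g v) i"
      unfolding B_def using q by (intro fa.act_Union) (auto simp: subgrad_supports_def simp del: UN_simps)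
    moreover have "D b \<in> subgrad_supports g v b" if "b \<in> B" for b
      unfolding D_def
    proof (rule ga.act_Union)
      show "(\<lambda>j. supp (Q j $ b)) ` {j \<in> A. b \<in> supp (q j)} \<noteq> {}"
        using that by (auto simp: B_def)
      have "Q j $ b \<in> subgrad g v b" if "j \<in> A" for j
        using Q[OF that] by (simp add: subdifferential_iff)
      then show "(\<lambda>j. supp (Q j $ b)) ` {j \<in> A. b \<in> supp (q j)} \<subseteq> subgrad_supports g v b"
        by (auto simp: subgrad_supports_def)
    qed
    moreover have "A = \<Union>(D ` B)"
    proof -
      have "\<Union>(D ` B) = (\<Union>j\<in>A. \<Union>b\<in>supp (q j). supp (Q j $ b))"
        by (auto simp: B_def D_def)
      also have "\<dots> = (\<Union>j\<in>A. supp (q j v* Q j))"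
        by (intro SUP_cong refl) (simp only: supp_prod[OF q Q])
      also have "\<dots> = A"
      proof
        show "(\<Union>j\<in>A. supp (q j v* Q j)) \<subseteq> A" using sub by (rule UN_least)
        show "A \<subseteq> (\<Union>j\<in>A. supp (q j v* Q j))" using j by (intro subsetI UN_I)
      qed
      finally show ?thesis ..
    qed
    ultimately show "A \<in> ?rhs" by (intro CollectI exI[of _ D] exI[of _ B] conjI ballI)
  }
qed

lemma subgrad_supports_id: "subgrad_supports id v i = {{i}}"
proof -
  have "p = axis i 1" if p: "p \<in> subgrad id v i" for p
  proof -
    have *: "p \<bullet> y \<le> y $ i" for y
    proof -
      have "p \<bullet> (y + v - v) \<le> id (y + v) $ i - id v $ i"
        using p by (simp only: subgrad_def mem_Collect_eq)
      then show ?thesis by simp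
    qed
    \<comment> \<open>Tested at z = p - e_i, the inequality p . y <= y_i reads |z|^2 <= 0.\<close>
    let ?z = "p - axis i 1"
    have "?z \<bullet> ?z = p \<bullet> ?z - axis i 1 \<bullet> ?z" by (rule inner_diff_left)
    also have "axis i 1 \<bullet> ?z = ?z $ i" unfolding inner_axis' by simp
    also have "p \<bullet> ?z - ?z $ i \<le> 0" using *[of ?z] by linarith
    finally have "?z = 0" using inner_gt_zero_iff[of ?z] by linarith
    then show ?thesis by simp
  qed
  moreover have "axis i 1 \<in> subgrad id v i"
  proof -
    have "axis i 1 \<bullet> z = z $ i" for z :: "real ^ 'a" unfolding inner_axis' by simp
    then show ?thesis
      by (simp only: subgrad_def mem_Collect_eq id_apply vector_minus_component order_refl simp_thms)
  qed
  ultimately have "subgrad id v i = {axis i 1}" by blast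
  moreover have "supp (axis i 1) = {i}" by (auto simp: supp_def axis_def)
  ultimately show ?thesis by (simp add: subgrad_supports_def)
qed

text \<open>The outer subgradients are taken at the image of v, which is v itself, so the chain rule
  iterates with a single family of supports.\<close>

lemma subgrad_supports_funpow:
  assumes f: "convex_monotone_map f" and v: "f v = v"
  shows "subgrad_supports (f ^^ k) v = act_power (subgrad_supports f v) k"
proof (induction k)
  case 0
  show ?case by (intro ext) (simp only: funpow.simps act_power.simps subgrad_supports_id)
next
  case (Suc k)
  have "(f ^^ k) v = v" using v by (induction k) auto
  then show ?case
    using Suc subgrad_supports_comp[OF f convex_monotone_map_funpow[OF f], of k v]
    by (intro ext) (simp add: o_def)
qed

section \<open>Fixed points\<close>

definition crit :: "(real ^ 'n \<Rightarrow> real ^ 'n) \<Rightarrow> real ^ 'n \<Rightarrow> 'n rel" where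
  "crit g v = critical_rel (subgrad_supports g v)"

definition matrix_rel :: "real ^ 'n ^ 'n \<Rightarrow> 'n rel" where
  "matrix_rel P = {(i, j). P $ i $ j \<noteq> 0}"

section \<open>Minimum principle and comparison of fixed points\<close>

text \<open>The minimum over the nodes reachable from i spreads from a minimiser to everything
  reachable from it; since walks can be returned, this includes i and j.\<close>

lemma superharmonic_const:
  fixes E :: "'n::finite rel" and p :: "'n \<Rightarrow> real ^ 'n"
  assumes conv: "E\<inverse> \<subseteq> E\<^sup>*"
    and supp: "\<And>i. i \<in> Field E \<Longrightarrow> supp (p i) = E `` {i}"
    and nonneg: "\<And>i j. i \<in> Field E \<Longrightarrow> p i $ j \<ge> 0"
    and sum: "\<And>i. i \<in> Field E \<Longrightarrow> sum (($) (p i)) UNIV = 1"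
    and super: "\<And>i. i \<in> Field E \<Longrightarrow> p i \<bullet> u \<le> u $ i"
    and i: "i \<in> Field E" and ij: "(i, j) \<in> E\<^sup>*"
  shows "u $ j = u $ i"
proof -
  let ?R = "E\<^sup>* `` {i}"
  have "Min (($) u ` ?R) \<in> ($) u ` ?R" by (intro Min_in) auto
  then obtain m where m: "(i, m) \<in> E\<^sup>*" and "u $ m = Min (($) u ` ?R)" by auto
  then have min: "u $ m \<le> u $ k" if "(i, k) \<in> E\<^sup>*" for k using that by simp
  have eq: "u $ k = u $ m" if "(m, k) \<in> E\<^sup>*" for k
    using that
  proof (induction rule: rtrancl_induct)
    case (step k l)
    have k: "(i, k) \<in> E\<^sup>*" using m step(1) by (rule rtrancl_trans)
    then have kF: "k \<in> Field E" using i by (rule rtrancl_closed_Field)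
    show ?case
    proof (rule average_eq_min[OF nonneg[OF kF] sum[OF kF]])
      show "u $ m \<le> u $ h" if "h \<in> supp (p k)" for h
        using that min k by (auto simp: supp[OF kF] intro: rtrancl_into_rtrancl)
      show "p k \<bullet> u \<le> u $ m" using super[OF kF] step(3) by simp
      show "l \<in> supp (p k)" using step(2) by (simp add: supp[OF kF])
    qed
  qed simp
  have "(m, i) \<in> E\<^sup>*" using sym_rtrancl_if_converse_subset[OF conv] m by (rule symD)
  then show ?thesis using eq[of i] eq[of j] ij by (metis rtrancl_trans)
qed

context convex_monotone_map
begin

lemma crit_converse: "(crit f v)\<inverse> \<subseteq> (crit f v)\<^sup>*"
  unfolding crit_def by (rule action_sets.critical_converse[OF action_sets_subgrad_supports])

lemma crit_upper: "recurrent_rel (subgrad_supports f v) E \<Longrightarrow> E \<subseteq> crit f v"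
  unfolding crit_def by (rule action_sets.critical_rel_upper[OF action_sets_subgrad_supports])

text \<open>One selection of rows realises the whole critical relation; outside its field the rows
  are arbitrary subgradients.\<close>

lemma crit_rows:
  obtains p where "\<And>i. p i \<in> subgrad f v i"
    "\<And>i. i \<in> Field (crit f v) \<Longrightarrow> supp (p i) = crit f v `` {i}"
proof -
  have "\<exists>p. p \<in> subgrad f v i \<and> (i \<in> Field (crit f v) \<longrightarrow> supp p = crit f v `` {i})" for i
  proof (cases "i \<in> Field (crit f v)")
    case True
    then have "crit f v `` {i} \<in> supp ` subgrad f v i"
      using action_sets.critical_row[OF action_sets_subgrad_supports]
      unfolding crit_def subgrad_supports_def by blast
    then show ?thesis by force
  qed (use subgrad_nonempty in auto)
  then obtain p where "\<And>i. p i \<in> subgrad f v i \<and> (i \<in> Field (crit f v) \<longrightarrow> supp (p i) = crit f v `` {i})"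
    using choice[of "\<lambda>i p. p \<in> subgrad f v i \<and> (i \<in> Field (crit f v) \<longrightarrow> supp p = crit f v `` {i})"] by blast
  then show thesis by (intro that[of p]) simp_all
qed

lemma superfixed_const:
  assumes v: "f v = v" and z: "f z \<le> z"
    and i: "i \<in> Field (crit f v)" and ij: "(i, j) \<in> (crit f v)\<^sup>*"
  shows "(z - v) $ j = (z - v) $ i"
proof -
  obtain p where p: "\<And>i. p i \<in> subgrad f v i"
    "\<And>i. i \<in> Field (crit f v) \<Longrightarrow> supp (p i) = crit f v `` {i}" by (rule crit_rows[of v]) (rule that)
  show ?thesis
  proof (rule superharmonic_const[OF crit_converse p(2) subgrad_nonneg[OF p(1)] subgrad_sum[OF p(1)] _ i ij])
    fix k
    have "p k \<bullet> (z - v) \<le> f z $ k - f v $ k" using p(1)[of k] by (simp add: subgrad_def)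
    also have "\<dots> \<le> (z - v) $ k" using z by (simp add: v less_eq_vec_def)
    finally show "p k \<bullet> (z - v) \<le> (z - v) $ k" .
  qed
qed

lemma superfixed_fixed_on_critical:
  assumes v: "f v = v" and z: "f z \<le> z" and i: "i \<in> Field (crit f v)"
  shows "f z $ i = z $ i"
proof -
  obtain p where p: "\<And>i. p i \<in> subgrad f v i"
    "\<And>i. i \<in> Field (crit f v) \<Longrightarrow> supp (p i) = crit f v `` {i}" by (rule crit_rows[of v]) (rule that)
  have "p i \<bullet> (z - v) = (z - v) $ i"
  proof (rule average_const[OF subgrad_sum[OF p(1)]])
    show "(z - v) $ j = (z - v) $ i" if "j \<in> supp (p i)" for j
      using that p(2)[OF i] by (intro superfixed_const[OF v z i]) auto
  qed
  moreover have "p i \<bullet> (z - v) \<le> f z $ i - f v $ i" using p(1)[of i] by (simp add: subgrad_def)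
  ultimately show ?thesis using z v by (simp add: less_eq_vec_def antisym)
qed

text \<open>A critical row p at v satisfies p . (w - v) = (w - v)_i, because w - v is constant on
  critical classes. Moving the base point to w therefore leaves the subgradient inequality
  intact.\<close>

lemma crit_subset_fixed:
  assumes v: "f v = v" and w: "f w = w"
  shows "crit f v \<subseteq> crit f w"
proof (rule crit_upper)
  obtain p where p: "\<And>i. p i \<in> subgrad f v i"
    "\<And>i. i \<in> Field (crit f v) \<Longrightarrow> supp (p i) = crit f v `` {i}" by (rule crit_rows[of v]) (rule that)
  have "crit f v `` {i} \<in> subgrad_supports f w i" if i: "i \<in> Field (crit f v)" for i
  proof -
    have "p i \<bullet> (w - v) = (w - v) $ i"
    proof (rule average_const[OF subgrad_sum[OF p(1)]])
      show "(w - v) $ j = (w - v) $ i" if "j \<in> supp (p i)" for j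
        using that p(2)[OF i] w by (intro superfixed_const[OF v _ i]) auto
    qed
    then have "p i \<bullet> (x - w) = p i \<bullet> (x - v) - (w - v) $ i" for x
      by (simp add: inner_diff_right)
    moreover have "p i \<bullet> (x - v) \<le> f x $ i - v $ i" for x
      using p(1)[of i] v by (simp add: subgrad_def)
    ultimately have "p i \<bullet> (x - w) \<le> f x $ i - f w $ i" for x
      by (simp add: w le_diff_eq)
    then have "p i \<in> subgrad f w i" by (simp add: subgrad_def)
    then show ?thesis using p(2)[OF i] by (auto simp: subgrad_supports_def)
  qed
  then show "recurrent_rel (subgrad_supports f w) (crit f v)"
    using crit_converse by (simp add: recurrent_rel_def)
qed

lemma crit_fixed_eq: "f v = v \<Longrightarrow> f w = w \<Longrightarrow> crit f v = crit f w"
  using crit_subset_fixed by blast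

lemma recurrent_matrix_rel:
  assumes P: "P \<in> subdifferential f v"
  defines "R \<equiv> {a. \<forall>b. (a, b) \<in> (matrix_rel P)\<^sup>* \<longrightarrow> (b, a) \<in> (matrix_rel P)\<^sup>*}"
  shows "{(a, b) \<in> matrix_rel P. a \<in> R} \<subseteq> crit f v" "R \<subseteq> Field (crit f v)"
proof -
  have "matrix_rel P `` {a} \<in> subgrad_supports f v a" for a
    using P by (auto simp: subdifferential_iff subgrad_supports_def matrix_rel_def supp_def)
  note rec = recurrent_part[OF this action_sets.empty_notin_act[OF action_sets_subgrad_supports]]
  show 1: "{(a, b) \<in> matrix_rel P. a \<in> R} \<subseteq> crit f v"
    unfolding R_def by (rule crit_upper[OF rec(1)])
  show "R \<subseteq> Field (crit f v)"
    using mono_Field[OF 1] rec(2) unfolding R_def by simp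
qed

text \<open>The minimum of y - x spreads along a subgradient matrix at x until it meets a final
  class. The nodes of that class are critical, and there the hypothesis bounds it from below by
  0.\<close>

lemma fixed_le_if_le_on_critical:
  assumes v: "f v = v" and x: "f x = x" and y: "f y = y"
    and le: "\<And>i. i \<in> Field (crit f v) \<Longrightarrow> x $ i \<le> y $ i"
  shows "x \<le> y"
proof -
  \<comment> \<open>Taken at x, not at v, so that P(y - x) <= y - x; the critical relations at x and
    v coincide.\<close>
  obtain P where P: "P \<in> subdifferential f x" using subdifferential_nonempty by blast
  let ?u = "y - x"
  have row: "P $ i \<in> subgrad f x i" for i using P by (simp add: subdifferential_iff)
  have "Min (range (($) ?u)) \<in> range (($) ?u)" by (intro Min_in) auto
  then obtain m where m: "Min (range (($) ?u)) = ?u $ m" by (rule rangeE)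
  have min: "?u $ m \<le> ?u $ k" for k unfolding m[symmetric] by (intro Min_le) auto
  obtain b where b: "(m, b) \<in> (matrix_rel P)\<^sup>*"
    "\<forall>c. (b, c) \<in> (matrix_rel P)\<^sup>* \<longrightarrow> (c, b) \<in> (matrix_rel P)\<^sup>*"
    by (rule ex_recurrent_reachable)
  from b(1) have "?u $ b = ?u $ m"
  proof (induction rule: rtrancl_induct)
    case (step k l)
    show ?case
    proof (rule average_eq_min[OF subgrad_nonneg[OF row] subgrad_sum[OF row]])
      show "?u $ m \<le> ?u $ h" for h by (rule min)
      have "P $ k \<bullet> ?u \<le> f y $ k - f x $ k" using row[of k] by (simp add: subgrad_def)
      then show "P $ k \<bullet> ?u \<le> ?u $ m" using x y step(3) by simp
      show "l \<in> supp (P $ k)" using step(2) by (simp add: matrix_rel_def supp_def)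
    qed
  qed simp
  moreover have "b \<in> Field (crit f v)"
    using recurrent_matrix_rel(2)[OF P] b(2) crit_fixed_eq[OF v x] by auto
  ultimately have "?u $ m \<ge> 0" using le[of b] by simp
  then have "?u $ k \<ge> 0" for k using min[of k] by linarith
  then show ?thesis by (simp add: less_eq_vec_def)
qed

lemma superfixed_limit:
  assumes v: "f v = v" and z: "f z \<le> z"
  obtains w where "f w = w" "\<And>i. i \<in> Field (crit f v) \<Longrightarrow> w $ i = z $ i"
proof -
  define Z where "Z k = (f ^^ k) z" for k
  have Z_Suc: "Z (Suc k) = f (Z k)" for k by (simp add: Z_def)
  have super: "f (Z k) \<le> Z k" for k
    by (induction k) (use z in \<open>auto simp: Z_Suc Z_def[of 0] intro: monoD[OF mono]\<close>)
  \<comment> \<open>Comparison with the fixed point v bounds all iterates from below, uniformly in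
    k.\<close>
  have lower: "v $ i \<le> Z k $ i + norm (v - z)" for k i
  proof (induction k arbitrary: i)
    case 0
    show ?case using component_le_norm_cart[of "v - z" i] by (simp add: Z_def)
  next
    case (Suc k)
    then show ?case using le_shift[of v "Z k" "norm (v - z)" i] v by (simp add: Z_Suc)
  qed
  have "\<exists>L. (\<lambda>k. Z k $ i) \<longlonglongrightarrow> L" for i
  proof (rule decseq_convergent[of "\<lambda>k. Z k $ i" "v $ i - norm (v - z)"])
    show "decseq (\<lambda>k. Z k $ i)"
      using super by (intro decseq_SucI) (simp add: Z_Suc less_eq_vec_def)
    show "\<forall>k. v $ i - norm (v - z) \<le> Z k $ i" using lower by (simp add: diff_le_eq)
  qed blast
  then obtain L where L: "\<And>i. (\<lambda>k. Z k $ i) \<longlonglongrightarrow> L i" by metis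
  let ?w = "\<chi> i. L i"
  have lim: "Z \<longlonglongrightarrow> ?w" by (rule vec_tendstoI) (simp add: L)
  have "(\<lambda>k. Z (Suc k)) \<longlonglongrightarrow> f ?w" unfolding Z_Suc by (rule tendsto_map[OF lim])
  then have "f ?w = ?w" using LIMSEQ_Suc[OF lim] LIMSEQ_unique by blast
  moreover have "?w $ i = z $ i" if i: "i \<in> Field (crit f v)" for i
  proof -
    have "Z k $ i = z $ i" for k
      by (induction k) (simp_all add: Z_def[of 0] Z_Suc superfixed_fixed_on_critical[OF v super i])
    then show ?thesis using L[of i] by (simp add: LIMSEQ_const_iff)
  qed
  ultimately show thesis by (rule that)
qed

section \<open>Shape of the restricted fixed-point set\<close>

text \<open>A convex combination or minimum of fixed points need not be fixed, but it satisfies f(z)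
  <= z and so has the same restriction as some fixed point.\<close>

lemma fixed_restrict_image:
  assumes v: "f v = v" and z: "f z \<le> z"
  shows "restrict_coords (Field (crit f v)) z \<in> restrict_coords (Field (crit f v)) ` {x. f x = x}"
proof -
  obtain w where "f w = w" "\<And>i. i \<in> Field (crit f v) \<Longrightarrow> w $ i = z $ i"
    by (rule superfixed_limit[OF v z]) (rule that)
  then show ?thesis
    by (intro image_eqI[of _ _ w]) (auto simp: restrict_coords_def vec_eq_iff)
qed

lemma convex_fixed_restrict:
  assumes v: "f v = v"
  shows "Convex.convex (restrict_coords (Field (crit f v)) ` {x. f x = x})"
proof (rule convexI, clarify)
  fix x y and a b :: real
  assume x: "f x = x" and y: "f y = y" and ab: "0 \<le> a" "0 \<le> b" "a + b = 1"
  let ?C = "Field (crit f v)"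
  have "f (a *\<^sub>R x + b *\<^sub>R y) $ i \<le> a * f x $ i + b * f y $ i" for i
    using convex ab unfolding coordinatewise_convex_def convex_on_def by blast
  then have "f (a *\<^sub>R x + b *\<^sub>R y) \<le> a *\<^sub>R x + b *\<^sub>R y"
    by (simp add: x y less_eq_vec_def)
  moreover have "a *\<^sub>R restrict_coords ?C x + b *\<^sub>R restrict_coords ?C y
      = restrict_coords ?C (a *\<^sub>R x + b *\<^sub>R y)"
    by (simp add: restrict_coords_def vec_eq_iff)
  ultimately show "a *\<^sub>R restrict_coords ?C x + b *\<^sub>R restrict_coords ?C y
      \<in> restrict_coords ?C ` {x. f x = x}"
    using fixed_restrict_image[OF v] by simp
qed

lemma inf_subsemilattice_fixed_restrict:
  assumes v: "f v = v"
  shows "inf_subsemilattice (Field (crit f v)) (restrict_coords (Field (crit f v)) ` {x. f x = x})"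
  unfolding inf_subsemilattice_def
proof (intro conjI ballI, goal_cases)
  case 1
  show ?case by (auto simp: coordinate_space_def restrict_coords_def)
next
  case (2 x' y')
  then obtain x y where x: "f x = x" "x' = restrict_coords (Field (crit f v)) x"
    and y: "f y = y" "y' = restrict_coords (Field (crit f v)) y" by auto
  have "f (inf x y) \<le> inf x y"
    using monoD[OF mono, of "inf x y" x] monoD[OF mono, of "inf x y" y] x y by simp
  moreover have "inf x' y' = restrict_coords (Field (crit f v)) (inf x y)"
    by (simp add: x y restrict_coords_def vec_eq_iff inf_vec_def)
  ultimately show ?case using fixed_restrict_image[OF v] by simp
qed

lemma aff_dim_fixed_restrict:
  assumes v: "f v = v"
  shows "aff_dim (restrict_coords (Field (crit f v)) ` {x. f x = x})
    \<le> int (card (Field (crit f v) // (crit f v)\<^sup>*))"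
proof -
  let ?E = "crit f v"
  let ?C = "Field ?E" and ?K = "Field ?E // ?E\<^sup>*"
  define ind :: "'n set \<Rightarrow> real ^ 'n" where "ind X = (\<chi> i. if i \<in> X then 1 else 0)" for X
  have eqv: "equiv UNIV (?E\<^sup>*)" by (rule equiv_rtrancl_if_converse_subset[OF crit_converse])
  have diff: "restrict_coords ?C x - restrict_coords ?C v \<in> span (ind ` ?K)" if x: "f x = x" for x
  proof -
    let ?u = "x - v"
    \<comment> \<open>x - v is constant on each class, so its entry at any representative is the
      coefficient of the class indicator.\<close>
    have "restrict_coords ?C x - restrict_coords ?C v = (\<Sum>X\<in>?K. ?u $ (SOME i. i \<in> X) *\<^sub>R ind X)"
      (is "?l = ?r")
    proof (subst vec_eq_iff, rule)
      fix i
      have "?r $ i = (\<Sum>X\<in>?K. if i \<in> X then ?u $ (SOME i. i \<in> X) else 0)"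
        unfolding sum_component by (intro sum.cong refl) (simp add: ind_def)
      also have "\<dots> = ?l $ i"
      proof (cases "i \<in> ?C")
        case True
        have "X = ?E\<^sup>* `` {i}" if X: "X \<in> ?K" "i \<in> X" for X
        proof -
          obtain k where "X = ?E\<^sup>* `` {k}" using X by (auto elim: quotientE)
          then show ?thesis using X equiv_class_eq[OF eqv, of k i] by simp
        qed
        then have iff: "i \<in> X \<longleftrightarrow> X = ?E\<^sup>* `` {i}" if "X \<in> ?K" for X using that by blast
        have "(\<Sum>X\<in>?K. if i \<in> X then ?u $ (SOME i. i \<in> X) else 0)
            = (\<Sum>X\<in>?K. if X = ?E\<^sup>* `` {i} then ?u $ (SOME i. i \<in> X) else 0)"
          by (intro sum.cong refl if_cong iff)
        also have "\<dots> = ?u $ (SOME k. k \<in> ?E\<^sup>* `` {i})"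
          using quotientI[OF True, of "?E\<^sup>*"] by simp
        also have "\<dots> = ?u $ i"
        proof -
          have "(i, SOME k. k \<in> ?E\<^sup>* `` {i}) \<in> ?E\<^sup>*"
            using someI[of "\<lambda>k. k \<in> ?E\<^sup>* `` {i}" i] by (simp only: Image_singleton_iff rtrancl.rtrancl_refl simp_thms)
          then show ?thesis unfolding Image_singleton_iff
            by (intro superfixed_const[OF v _ True]) (simp add: x)
        qed
        finally show ?thesis using True by (simp add: restrict_coords_def)
      next
        case False
        have "i \<notin> X" if X: "X \<in> ?K" for X
        proof -
          obtain k where "X = ?E\<^sup>* `` {k}" "k \<in> ?C" by (rule quotientE[OF X]) (rule that)
          then show ?thesis using False rtrancl_closed_Field by fastforce
        qed
        then show ?thesis using False by (simp add: restrict_coords_def)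
      qed
      finally show "?l $ i = ?r $ i" ..
    qed
    also have "\<dots> \<in> span (ind ` ?K)" by (intro span_sum span_scale span_base) auto
    finally show ?thesis .
  qed
  have "restrict_coords ?C ` {x. f x = x} \<subseteq> (+) (restrict_coords ?C v) ` span (ind ` ?K)"
  proof (intro image_subsetI)
    fix x assume "x \<in> {x. f x = x}"
    then show "restrict_coords ?C x \<in> (+) (restrict_coords ?C v) ` span (ind ` ?K)"
      by (intro image_eqI[of _ _ "restrict_coords ?C x - restrict_coords ?C v"] diff) simp_all
  qed
  then have "aff_dim (restrict_coords ?C ` {x. f x = x})
      \<le> aff_dim ((+) (restrict_coords ?C v) ` span (ind ` ?K))"
    by (rule aff_dim_subset)
  also have "\<dots> = int (dim (ind ` ?K))"
    by (simp add: aff_dim_translation_eq aff_dim_subspace)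
  also have "dim (ind ` ?K) \<le> card ?K"
    by (rule order_trans[OF dim_le_card' card_image_le]) simp_all
  finally show ?thesis by simp
qed

text \<open>Comparison at an index that maximises v - w gives l <= 0, and with the roles exchanged l
  >= 0. Hence the eigenvector picked in \<open>critical_graph\<close> is a fixed point.\<close>

lemma fixed_if_eigenvector:
  assumes w: "f w = w" and v: "eigenvector f v"
  shows "f v = v"
proof -
  obtain l where l: "f v = vec l + v" using v by (auto simp: eigenvector_def)
  have "l \<le> 0"
  proof -
    have "Max (range (($) (v - w))) \<in> range (($) (v - w))" by (intro Max_in) auto
    then obtain m where m: "Max (range (($) (v - w))) = (v - w) $ m" by (rule rangeE)
    have "(v - w) $ i \<le> (v - w) $ m" for i unfolding m[symmetric] by (intro Max_ge) auto
    then have "f v $ m \<le> f w $ m + (v - w) $ m"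
      by (intro le_shift) (simp add: algebra_simps)
    then show ?thesis by (simp add: l w)
  qed
  moreover have "l \<ge> 0"
  proof -
    have "Max (range (($) (w - v))) \<in> range (($) (w - v))" by (intro Max_in) auto
    then obtain m where m: "Max (range (($) (w - v))) = (w - v) $ m" by (rule rangeE)
    have "(w - v) $ i \<le> (w - v) $ m" for i unfolding m[symmetric] by (intro Max_ge) auto
    then have "f w $ m \<le> f v $ m + (w - v) $ m"
      by (intro le_shift) (simp add: algebra_simps)
    then show ?thesis by (simp add: l w)
  qed
  ultimately show ?thesis by (simp add: l vec_eq_iff)
qed

end

section \<open>Iterates and periodic points\<close>

lemma crit_funpow:
  assumes f: "convex_monotone_map f" and v: "f v = v" and k: "k > 0"
  shows "crit (f ^^ k) v = crit f v ^^ k"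
  using action_sets.critical_rel_act_power[OF convex_monotone_map.action_sets_subgrad_supports[OF f] k]
  by (simp add: crit_def subgrad_supports_funpow[OF f v])

lemma funpow_fixed: "f v = v \<Longrightarrow> (f ^^ k) v = v"
  by (induction k) auto

lemma periodic_imp_fixed_cyclicity:
  assumes f: "convex_monotone_map f" and v: "f v = v"
    and c: "c > 0" "\<And>S. S \<in> Field (crit f v) // (crit f v)\<^sup>* \<Longrightarrow> period (crit f v) S dvd c"
    and x: "(f ^^ p) x = x" "p > 0"
  shows "(f ^^ c) x = x"
proof -
  let ?E = "crit f v"
  \<comment> \<open>x and its images under \<open>f ^^ c\<close> are fixed by \<open>f ^^ N\<close>,
    and the orbit of x under \<open>f ^^ c\<close> closes after p steps.\<close>
  define N where "N = c * p"
  have N: "N > 0" using c x by (simp add: N_def)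
  interpret f: convex_monotone_map f by fact
  interpret fc: convex_monotone_map "f ^^ c" by (rule convex_monotone_map_funpow[OF f])
  interpret g: convex_monotone_map "f ^^ N" by (rule convex_monotone_map_funpow[OF f])
  have vN: "(f ^^ N) v = v" and vc: "(f ^^ c) v = v" by (rule funpow_fixed[of f, OF v])+
  have critN: "crit (f ^^ N) v = ?E ^^ N" by (rule crit_funpow[OF f v N])
  have critc: "crit (f ^^ c) v = ?E ^^ c" by (rule crit_funpow[OF f v c(1)])
  have FN: "Field (?E ^^ N) = Field ?E" by (rule Field_relpow[OF f.crit_converse N])
  have Fc: "Field (?E ^^ c) = Field ?E" by (rule Field_relpow[OF f.crit_converse c(1)])
  have incr: "y $ i \<le> (f ^^ c) y $ i" if y: "(f ^^ N) y = y" and i: "i \<in> Field ?E" for y i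
  proof -
    obtain q where q: "\<And>i. q i \<in> subgrad (f ^^ c) v i"
      "\<And>i. i \<in> Field (?E ^^ c) \<Longrightarrow> supp (q i) = (?E ^^ c) `` {i}"
      using fc.crit_rows[of v] unfolding critc by blast
    have "q i \<bullet> (y - v) = (y - v) $ i"
    proof (rule average_const[OF fc.subgrad_sum[OF q(1)]])
      fix j assume "j \<in> supp (q i)"
      then have j: "(i, j) \<in> ?E ^^ c" using q(2)[of i] i Fc by auto
      then have "j \<in> Field ?E" using i by (blast intro: rtrancl_closed_Field relpow_imp_rtrancl)
      then have "period ?E (?E\<^sup>* `` {j}) dvd c" by (intro c(2) quotientI)
      \<comment> \<open>The period divides the length c, so the arc stays inside one class of
        \<open>E ^^ N\<close>, where y - v is constant.\<close>
      then have "(i, j) \<in> (?E ^^ N)\<^sup>*"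
        by (rule period_dvd_imp_rtrancl_relpow[OF f.crit_converse N j])
      then show "(y - v) $ j = (y - v) $ i"
        using y i by (intro g.superfixed_const[OF vN]) (simp_all add: critN FN)
    qed
    moreover have "q i \<bullet> (y - v) \<le> (f ^^ c) y $ i - (f ^^ c) v $ i"
      using q(1)[of i] by (simp add: subgrad_def)
    ultimately show ?thesis by (simp add: vc)
  qed
  define Y where "Y k = (f ^^ (c * k)) x" for k
  have Y_Suc: "Y (Suc k) = (f ^^ c) (Y k)" for k by (simp add: Y_def funpow_add)
  have xN: "(f ^^ N) x = x"
    using funpow_fixed[of "f ^^ p", OF x(1), of c] by (simp add: N_def funpow_mult mult.commute)
  have YN: "(f ^^ N) (Y k) = Y k" for k
  proof -
    have "(f ^^ N) (Y k) = (f ^^ (c * k)) ((f ^^ N) x)"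
      by (simp add: Y_def add.commute flip: funpow_add[unfolded o_def, THEN fun_cong])
    then show ?thesis by (simp add: xN Y_def)
  qed
  have "(f ^^ c) x $ i = x $ i" if i: "i \<in> Field ?E" for i
  proof -
    \<comment> \<open>The entry at i never decreases along Y and is back at its initial value for k
      = p, so it does not move.\<close>
    have mono: "Y k $ i \<le> Y (k + m) $ i" for k m
    proof (induction m)
      case (Suc m)
      then show ?case using incr[OF YN[of "k + m"] i] by (simp add: Y_Suc)
    qed simp
    have "Y 1 $ i \<le> Y p $ i" using mono[of 1 "p - 1"] x by simp
    then have "(f ^^ c) x $ i \<le> x $ i" using xN by (simp add: Y_def N_def)
    then show ?thesis using incr[OF xN i] by simp
  qed
  then have on_crit: "(f ^^ c) x $ i = x $ i" if "i \<in> Field (crit (f ^^ N) v)" for i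
    using that by (simp add: critN FN)
  \<comment> \<open>x and its image are both fixed by \<open>f ^^ N\<close> and agree on its
    critical nodes, which determine a fixed point.\<close>
  have "(f ^^ N) ((f ^^ c) x) = (f ^^ c) x" using YN[of 1] by (simp add: Y_def)
  then show ?thesis
    using g.fixed_le_if_le_on_critical[OF vN _ xN] g.fixed_le_if_le_on_critical[OF vN xN] on_crit
    by (intro antisym) auto
qed

section \<open>Critical graphs\<close>

definition rel_graph :: "'n rel \<Rightarrow> 'n graph" where
  "rel_graph E = \<lparr>verts = Field E, arcs = E, tail = fst, head = snd\<rparr>"

lemma arcs_ends_pairs: "arcs_ends \<lparr>verts = V, arcs = E, tail = fst, head = snd\<rparr> = E"
  by (auto simp: arcs_ends_def arc_to_ends_def)

lemma wf_digraph_rel_graph: "wf_digraph (rel_graph E)"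
proof
  fix e assume "e \<in> arcs (rel_graph E)"
  then have e: "(fst e, snd e) \<in> E" by (simp add: rel_graph_def)
  show "tail (rel_graph E) e \<in> verts (rel_graph E)" "head (rel_graph E) e \<in> verts (rel_graph E)"
    using FieldI1[OF e] FieldI2[OF e] by (simp_all add: rel_graph_def)
qed

lemma reachable_rel_graph:
  "a \<rightarrow>\<^sup>*\<^bsub>rel_graph E\<^esub> b \<longleftrightarrow> a \<in> Field E \<and> (a, b) \<in> E\<^sup>*"
proof -
  interpret wf_digraph "rel_graph E" by (rule wf_digraph_rel_graph)
  have E: "arcs_ends (rel_graph E) = E" "verts (rel_graph E) = Field E"
    by (simp_all add: rel_graph_def arcs_ends_pairs)
  have "(a, b) \<in> E\<^sup>* \<Longrightarrow> a \<in> Field E \<Longrightarrow> b \<in> Field E" by (rule rtrancl_closed_Field)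
  then show ?thesis unfolding reachable_conv E by blast
qed

text \<open>\<open>E\<^sup>*\<close> is reflexive on the whole type; the quotient of
  \<open>Field E\<close> alone excludes singletons of elements that are not nodes.\<close>

lemma sccs_verts_rel_graph:
  assumes conv: "E\<inverse> \<subseteq> E\<^sup>*"
  shows "pre_digraph.sccs_verts (rel_graph E) = Field E // E\<^sup>*"
proof (intro equalityI subsetI)
  have sym: "sym (E\<^sup>*)" by (rule sym_rtrancl_if_converse_subset[OF conv])
  {
    fix S assume "S \<in> pre_digraph.sccs_verts (rel_graph E)"
    then have *: "S \<noteq> {} \<and> (\<forall>u\<in>S. \<forall>w\<in>S. u \<in> Field E \<and> (u, w) \<in> E\<^sup>*) \<and>
      (\<forall>u\<in>S. \<forall>w. w \<notin> S \<longrightarrow>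
        \<not> (u \<in> Field E \<and> (u, w) \<in> E\<^sup>*) \<or> \<not> (w \<in> Field E \<and> (w, u) \<in> E\<^sup>*))"
      unfolding pre_digraph.sccs_verts_def reachable_rel_graph mem_Collect_eq .
    then have ne: "S \<noteq> {}" by (rule conjunct1)
    have S: "u \<in> Field E" "(u, w) \<in> E\<^sup>*" if "u \<in> S" "w \<in> S" for u w
      using *[THEN conjunct2, THEN conjunct1] that by simp_all
    have max: "\<not> (u \<in> Field E \<and> (u, w) \<in> E\<^sup>*) \<or> \<not> (w \<in> Field E \<and> (w, u) \<in> E\<^sup>*)"
      if "u \<in> S" "w \<notin> S" for u w
      using *[THEN conjunct2, THEN conjunct2] that by simp
    obtain a where a: "a \<in> S" using ne by blast
    have "S = E\<^sup>* `` {a}"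
    proof (intro equalityI subsetI)
      fix b assume "b \<in> S"
      then show "b \<in> E\<^sup>* `` {a}" using S(2)[OF a] by simp
    next
      fix b assume "b \<in> E\<^sup>* `` {a}"
      then have b: "(a, b) \<in> E\<^sup>*" by simp
      have "b \<in> Field E" by (rule rtrancl_closed_Field[OF b S(1)[OF a a]])
      moreover have "(b, a) \<in> E\<^sup>*" by (rule symD[OF sym b])
      ultimately show "b \<in> S" using max[OF a, of b] S(1)[OF a a] b by blast
    qed
    then show "S \<in> Field E // E\<^sup>*" using quotientI[OF S(1)[OF a a], of "E\<^sup>*"] by simp
  next
    fix S assume "S \<in> Field E // E\<^sup>*"
    then obtain a where a: "a \<in> Field E" "S = E\<^sup>* `` {a}" by (rule quotientE)
    show "S \<in> pre_digraph.sccs_verts (rel_graph E)"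
      unfolding pre_digraph.sccs_verts_def reachable_rel_graph
    proof (intro CollectI conjI ballI allI impI)
      show "S \<noteq> {}" using a by blast
      show "u \<in> Field E" if "u \<in> S" for u
        using that a rtrancl_closed_Field[of a u E] by simp
      fix u w assume u: "u \<in> S"
      then have au: "(a, u) \<in> E\<^sup>*" using a by simp
      have ua: "(u, a) \<in> E\<^sup>*" by (rule symD[OF sym au])
      show "(u, w) \<in> E\<^sup>*" if "w \<in> S" using that a rtrancl_trans[OF ua, of w] by simp
      show "\<not> (u \<in> Field E \<and> (u, w) \<in> E\<^sup>*) \<or> \<not> (w \<in> Field E \<and> (w, u) \<in> E\<^sup>*)"
        if "w \<notin> S" using that a rtrancl_trans[OF au, of w] by auto
    qed
  }
qed

lemma relpow_Suc_iff: "(u, w) \<in> E ^^ Suc l \<longleftrightarrow> (\<exists>y. (u, y) \<in> E \<and> (y, w) \<in> E ^^ l)"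
  unfolding relpow.simps relpow_commute[symmetric] by blast

text \<open>\<open>cas\<close> only checks that consecutive ends match; membership of the arcs is
  the separate condition on \<open>set p\<close>.\<close>

lemma cas_pairs_iff_relpow:
  "(\<exists>p. length p = l \<and> set p \<subseteq> F
      \<and> pre_digraph.cas \<lparr>verts = V, arcs = A, tail = fst, head = snd\<rparr> u p w)
    \<longleftrightarrow> (u, w) \<in> F ^^ l"
proof (induction l arbitrary: u)
  case 0
  then show ?case by (simp add: pre_digraph.cas.simps)
next
  case (Suc l)
  let ?cas = "pre_digraph.cas \<lparr>verts = V, arcs = A, tail = fst, head = snd\<rparr>"
  have "(\<exists>p. length p = Suc l \<and> set p \<subseteq> F \<and> ?cas u p w)
      \<longleftrightarrow> (\<exists>y. (u, y) \<in> F \<and> (\<exists>p. length p = l \<and> set p \<subseteq> F \<and> ?cas y p w))"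
    (is "?L \<longleftrightarrow> ?R")
  proof
    assume ?L
    then obtain q where q: "length q = Suc l" "set q \<subseteq> F" "?cas u q w" by blast
    then obtain e p where "q = e # p" by (cases q) simp_all
    with q have "length p = l" "set (e # p) \<subseteq> F" "?cas u (e # p) w" by simp_all
    then show ?R by (cases e) (auto simp: pre_digraph.cas.simps)
  next
    assume ?R
    then obtain y p where "(u, y) \<in> F" "length p = l" "set p \<subseteq> F" "?cas y p w" by blast
    then show ?L by (intro exI[of _ "(u, y) # p"]) (simp add: pre_digraph.cas.simps)
  qed
  also have "\<dots> \<longleftrightarrow> (u, w) \<in> F ^^ Suc l"
    unfolding Suc relpow_Suc_iff ..
  finally show ?case .
qed

lemma relpow_restrict_closed:
  assumes "\<And>a b. a \<in> S \<Longrightarrow> (a, b) \<in> E \<Longrightarrow> b \<in> S" and u: "u \<in> S"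
  shows "(u, w) \<in> {e \<in> E. fst e \<in> S \<and> snd e \<in> S} ^^ l \<longleftrightarrow> (u, w) \<in> E ^^ l"
  using u
proof (induction l arbitrary: u)
  case (Suc l)
  let ?F = "{e \<in> E. fst e \<in> S \<and> snd e \<in> S}"
  have "(u, w) \<in> ?F ^^ Suc l \<longleftrightarrow> (\<exists>y. (u, y) \<in> ?F \<and> (y, w) \<in> ?F ^^ l)"
    by (rule relpow_Suc_iff)
  also have "\<dots> \<longleftrightarrow> (\<exists>y. (u, y) \<in> E \<and> (y, w) \<in> E ^^ l)"
  proof (intro ex_cong1 conj_cong)
    show "(u, y) \<in> ?F \<longleftrightarrow> (u, y) \<in> E" for y using assms(1) Suc.prems by auto
    show "(y, w) \<in> ?F ^^ l \<longleftrightarrow> (y, w) \<in> E ^^ l" if "(u, y) \<in> E" for y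
      by (rule Suc.IH[OF assms(1)[OF Suc.prems that]])
  qed
  also have "\<dots> \<longleftrightarrow> (u, w) \<in> E ^^ Suc l"
    by (rule relpow_Suc_iff[symmetric])
  finally show ?case .
qed simp

text \<open>A class cannot be left along E, so the closed walks at its nodes are circuits of the
  induced subgraph.\<close>

lemma graph_cyclicity_rel_graph:
  assumes S: "S \<in> Field E // E\<^sup>*"
  shows "graph_cyclicity (rel_graph E \<restriction> S) = period E S"
proof -
  let ?F = "{e \<in> E. fst e \<in> S \<and> snd e \<in> S}"
  have G: "rel_graph E \<restriction> S = \<lparr>verts = S, arcs = ?F, tail = fst, head = snd\<rparr>"
    by (simp add: induce_subgraph_def rel_graph_def)
  obtain r where r: "S = E\<^sup>* `` {r}" using S by (auto elim: quotientE)
  have closed: "b \<in> S" if "a \<in> S" "(a, b) \<in> E" for a b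
    using that unfolding r by (auto intro: rtrancl_into_rtrancl)
  have "(\<exists>u p. l = length p \<and> pre_digraph.awalk (rel_graph E \<restriction> S) u p u \<and> p \<noteq> [])
      \<longleftrightarrow> l > 0 \<and> (\<exists>u\<in>S. (u, u) \<in> E ^^ l)" for l
  proof -
    have "(\<exists>u p. l = length p \<and> pre_digraph.awalk (rel_graph E \<restriction> S) u p u \<and> p \<noteq> [])
      \<longleftrightarrow> l > 0 \<and> (\<exists>u\<in>S. \<exists>p. length p = l \<and> set p \<subseteq> ?F
        \<and> pre_digraph.cas \<lparr>verts = S, arcs = ?F, tail = fst, head = snd\<rparr> u p u)"
    proof -
      have "(\<exists>u p. l = length p \<and> (u \<in> S \<and> A p \<and> B u p) \<and> p \<noteq> [])
        \<longleftrightarrow> l > 0 \<and> (\<exists>u\<in>S. \<exists>p. length p = l \<and> A p \<and> B u p)"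
        for A :: "('a \<times> 'a) list \<Rightarrow> bool" and B
        by auto
      then show ?thesis unfolding G pre_digraph.awalk_def pre_digraph.select_convs .
    qed
    moreover have "(\<exists>u\<in>S. (u, u) \<in> ?F ^^ l) \<longleftrightarrow> (\<exists>u\<in>S. (u, u) \<in> E ^^ l)"
      by (intro bex_cong refl relpow_restrict_closed) (rule closed)
    ultimately show ?thesis unfolding cas_pairs_iff_relpow by (simp only:)
  qed
  then show ?thesis unfolding graph_cyclicity_def period_def by simp
qed

lemma sccs_rel_graph:
  assumes conv: "E\<inverse> \<subseteq> E\<^sup>*"
  shows "pre_digraph.sccs (rel_graph E) = (\<lambda>S. rel_graph E \<restriction> S) ` (Field E // E\<^sup>*)"
    and "verts ` pre_digraph.sccs (rel_graph E) = Field E // E\<^sup>*"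
proof -
  interpret wf_digraph "rel_graph E" by (rule wf_digraph_rel_graph)
  show "sccs = (\<lambda>S. rel_graph E \<restriction> S) ` (Field E // E\<^sup>*)"
    unfolding sccs_conv_sccs_verts sccs_verts_rel_graph[OF conv] ..
  show "verts ` sccs = Field E // E\<^sup>*"
    unfolding sccs_verts_conv[symmetric] sccs_verts_rel_graph[OF conv] ..
qed

lemma Union_final_classes:
  fixes P :: "real ^ 'n ^ 'n"
  shows "\<Union>(final_classes (matrix_graph P)) =
    {a. \<forall>b. (a, b) \<in> (matrix_rel P)\<^sup>* \<longrightarrow> (b, a) \<in> (matrix_rel P)\<^sup>*}" (is "?U = ?R")
proof -
  let ?G = "matrix_graph P" and ?E = "matrix_rel P"
  have G: "?G = \<lparr>verts = UNIV, arcs = ?E, tail = fst, head = snd\<rparr>"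
    by (simp add: matrix_graph_def matrix_rel_def)
  interpret wf_digraph ?G by standard (simp_all add: G)
  have reach: "a \<rightarrow>\<^sup>*\<^bsub>?G\<^esub> b \<longleftrightarrow> (a, b) \<in> ?E\<^sup>*" for a b
    unfolding reachable_conv unfolding G arcs_ends_pairs by simp
  show ?thesis
  proof (intro equalityI subsetI)
    fix a assume "a \<in> ?U"
    then obtain S where S: "S \<in> final_classes ?G" "a \<in> S" by blast
    have "(b, a) \<in> ?E\<^sup>*" if "(a, b) \<in> ?E\<^sup>*" for b
    proof -
      have "b \<in> S" using S that unfolding final_classes_def reach by blast
      then show ?thesis using S unfolding final_classes_def sccs_verts_def reach by blast
    qed
    then show "a \<in> ?R" by blast
  next
    fix a assume a: "a \<in> ?R"
    have backward: "(b, a) \<in> ?E\<^sup>*" if "(a, b) \<in> ?E\<^sup>*" for b using a that by blast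
    have "?E\<^sup>* `` {a} \<in> final_classes ?G"
      unfolding final_classes_def sccs_verts_def reach
    proof (intro CollectI conjI ballI allI impI)
      show "?E\<^sup>* `` {a} \<noteq> {}" by blast
      fix u w assume u: "u \<in> ?E\<^sup>* `` {a}"
      show "(u, w) \<in> ?E\<^sup>*" if "w \<in> ?E\<^sup>* `` {a}"
        using backward[of u] u that by (auto intro: rtrancl_trans)
      show "(u, w) \<notin> ?E\<^sup>* \<or> (w, u) \<notin> ?E\<^sup>*" if "w \<notin> ?E\<^sup>* `` {a}"
        using u that by (auto intro: rtrancl_trans)
      show "w \<in> ?E\<^sup>* `` {a}" if "(u, w) \<in> ?E\<^sup>*"
        using u that by (auto intro: rtrancl_trans)
    qed
    then show "a \<in> ?U" by blast
  qed
qed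

context convex_monotone_map
begin

text \<open>Each final graph is recurrent, hence contained in \<open>crit\<close>. Conversely, the
  matrix Q assembled from \<open>crit_rows\<close> has a final graph containing all of
  \<open>crit\<close>: one matrix attains the union.\<close>

lemma critical_graph_at_eq: "critical_graph_at f v = rel_graph (crit f v)"
proof -
  let ?C = "crit f v"
  let ?R = "\<lambda>P. {a. \<forall>b. (a, b) \<in> (matrix_rel P)\<^sup>* \<longrightarrow> (b, a) \<in> (matrix_rel P)\<^sup>*}"
  have verts: "verts (final_graph P) = ?R P" for P :: "real ^ 'n ^ 'n"
    by (simp only: final_graph_def induce_subgraph_verts Union_final_classes)
  have arcs: "arcs (final_graph P) = {(a, b) \<in> matrix_rel P. a \<in> ?R P}" for P :: "real ^ 'n ^ 'n"
  proof -
    have "arcs (final_graph P) = {e \<in> matrix_rel P. fst e \<in> ?R P \<and> snd e \<in> ?R P}"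
      unfolding Union_final_classes[symmetric] final_graph_def
      by (simp add: matrix_graph_def matrix_rel_def)
    moreover have "b \<in> ?R P" if ab: "(a, b) \<in> matrix_rel P" and a: "a \<in> ?R P" for a b
    proof -
      have "(c, b) \<in> (matrix_rel P)\<^sup>*" if "(b, c) \<in> (matrix_rel P)\<^sup>*" for c
      proof -
        have "(a, c) \<in> (matrix_rel P)\<^sup>*" using ab that by (rule converse_rtrancl_into_rtrancl)
        then have "(c, a) \<in> (matrix_rel P)\<^sup>*" using a by blast
        then show ?thesis using ab by (rule rtrancl_into_rtrancl)
      qed
      then show ?thesis by blast
    qed
    ultimately show ?thesis by fastforce
  qed
  obtain p where p: "\<And>i. p i \<in> subgrad f v i"
    "\<And>i. i \<in> Field ?C \<Longrightarrow> supp (p i) = ?C `` {i}" by (rule crit_rows[of v]) (rule that)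
  define Q where "Q = (\<chi> i. p i)"
  have Q: "Q \<in> subdifferential f v" using p by (simp add: Q_def subdifferential_iff)
  have row: "matrix_rel Q `` {i} = ?C `` {i}" if "i \<in> Field ?C" for i
    using p(2)[OF that] by (auto simp: Q_def matrix_rel_def supp_def)
  have CQ: "?C \<subseteq> matrix_rel Q"
  proof (rule subrelI)
    fix a b assume ab: "(a, b) \<in> ?C"
    then have "b \<in> matrix_rel Q `` {a}" using row[OF FieldI1[OF ab]] by simp
    then show "(a, b) \<in> matrix_rel Q" by simp
  qed
  have recurrent: "a \<in> ?R Q" if a: "a \<in> Field ?C" for a
  proof -
    have "(b, a) \<in> (matrix_rel Q)\<^sup>*" if "(a, b) \<in> (matrix_rel Q)\<^sup>*" for b
    proof -
      \<comment> \<open>On the field of \<open>crit\<close> the rows of Q are critical rows, so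
        walks of Q starting there never leave it.\<close>
      from that have "(a, b) \<in> ?C\<^sup>*"
      proof (induction rule: rtrancl_induct)
        case (step b c)
        have "b \<in> Field ?C" using step(3) a by (rule rtrancl_closed_Field)
        then have "c \<in> ?C `` {b}" using row[of b] step(2) by blast
        then show ?case using step(3) by (auto intro: rtrancl_into_rtrancl)
      qed simp
      then have "(b, a) \<in> ?C\<^sup>*" using sym_rtrancl_if_converse_subset[OF crit_converse] by (rule symD[rotated])
      then show ?thesis using rtrancl_mono[OF CQ] by blast
    qed
    then show ?thesis by blast
  qed
  have "(\<Union>P\<in>subdifferential f v. arcs (final_graph P)) = ?C"
  proof
    show "(\<Union>P\<in>subdifferential f v. arcs (final_graph P)) \<subseteq> ?C"
      unfolding arcs by (intro UN_least recurrent_matrix_rel(1))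
    have "?C \<subseteq> arcs (final_graph Q)"
      unfolding arcs using CQ recurrent by (auto dest: FieldI1)
    then show "?C \<subseteq> (\<Union>P\<in>subdifferential f v. arcs (final_graph P))" using Q by blast
  qed
  moreover have "(\<Union>P\<in>subdifferential f v. verts (final_graph P)) = Field ?C"
  proof
    show "(\<Union>P\<in>subdifferential f v. verts (final_graph P)) \<subseteq> Field ?C"
      unfolding verts by (intro UN_least recurrent_matrix_rel(2))
    show "Field ?C \<subseteq> (\<Union>P\<in>subdifferential f v. verts (final_graph P))"
      unfolding verts using recurrent Q by blast
  qed
  ultimately show ?thesis by (simp add: critical_graph_at_def rel_graph_def)
qed

lemma critical_graph_eq:
  assumes v: "f v = v"
  shows "critical_graph f = rel_graph (crit f v)"
proof -
  have "eigenvector f v" by (auto simp: eigenvector_def v vec_eq_iff intro!: exI[of _ 0])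
  then have "eigenvector f (SOME v. eigenvector f v)" by (rule someI)
  then have "f (SOME v. eigenvector f v) = (SOME v. eigenvector f v)"
    by (rule fixed_if_eigenvector[OF v])
  then show ?thesis
    unfolding critical_graph_def critical_graph_at_eq by (simp only: crit_fixed_eq[OF v])
qed

lemma critical_classes_eq:
  assumes v: "f v = v"
  shows "critical_classes f = Field (crit f v) // (crit f v)\<^sup>*"
  unfolding critical_classes_def critical_graph_eq[OF v] by (rule sccs_rel_graph(2)[OF crit_converse])

lemma sum_graph_cyclicity:
  assumes v: "f v = v"
  shows "(\<Sum>G\<in>critical_components f. graph_cyclicity G)
    = (\<Sum>S\<in>Field (crit f v) // (crit f v)\<^sup>*. period (crit f v) S)"
proof -
  \<comment> \<open>The node set recovers the class, so the sum over component graphs is a sum over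
    classes.\<close>
  have inj: "inj_on (\<lambda>S. rel_graph (crit f v) \<restriction> S) X" for X
    by (rule inj_onI) (metis induce_subgraph_verts)
  show ?thesis
    unfolding critical_graph_eq[OF v] sccs_rel_graph(1)[OF crit_converse] sum.reindex[OF inj]
    by (intro sum.cong refl) (simp add: graph_cyclicity_rel_graph)
qed

lemma map_cyclicity_eq:
  assumes v: "f v = v"
  shows "map_cyclicity f = Lcm (period (crit f v) ` (Field (crit f v) // (crit f v)\<^sup>*))"
  unfolding map_cyclicity_def critical_graph_eq[OF v] sccs_rel_graph(1)[OF crit_converse] image_image
  by (intro arg_cong[where f = Lcm] image_cong refl graph_cyclicity_rel_graph)

lemma map_cyclicity_pos:
  assumes v: "f v = v"
  shows "map_cyclicity f > 0"
proof -
  have "0 \<notin> period (crit f v) ` (Field (crit f v) // (crit f v)\<^sup>*)"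
  proof
    assume "0 \<in> period (crit f v) ` (Field (crit f v) // (crit f v)\<^sup>*)"
    then obtain S where "period (crit f v) S = 0" "S \<in> Field (crit f v) // (crit f v)\<^sup>*"
      by (elim imageE) simp
    then show False using period_pos[OF crit_converse, of S v] by simp
  qed
  then have "map_cyclicity f \<noteq> 0"
    unfolding map_cyclicity_eq[OF v] by (subst Lcm_0_iff) simp_all
  then show ?thesis by simp
qed

end

section \<open>Periodic orbits and the theorem\<close>

lemma Union_periodic_orbits: "\<Union>(periodic_orbits f) = {x. \<exists>p>0. (f ^^ p) x = x}"
proof (intro equalityI subsetI)
  fix y assume "y \<in> \<Union>(periodic_orbits f)"
  then obtain x c k where c: "c \<ge> 1" "(f ^^ c) x = x" and y: "y = (f ^^ k) x"
    unfolding periodic_orbits_def by blast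
  have "(f ^^ c) y = (f ^^ k) ((f ^^ c) x)"
    unfolding y by (metis add.commute comp_apply funpow_add)
  then show "y \<in> {x. \<exists>p>0. (f ^^ p) x = x}" using c y by (auto intro!: exI[of _ c])
next
  fix x assume "x \<in> {x. \<exists>p>0. (f ^^ p) x = x}"
  then obtain p where p: "p \<ge> 1" "(f ^^ p) x = x" by (auto simp: Suc_le_eq)
  then have "{(f ^^ k) x | k. True} \<in> periodic_orbits f"
    unfolding periodic_orbits_def by blast
  moreover have "x \<in> {(f ^^ k) x | k. True}" by (auto intro!: exI[of _ 0])
  ultimately show "x \<in> \<Union>(periodic_orbits f)" by blast
qed

theorem corollary5p9:
  fixes f :: "real ^ 'n \<Rightarrow> real ^ 'n"
  assumes "coordinatewise_convex f"
    and "mono f"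
    and "additively_homogeneous f"
    and "\<exists>x. f x = x"
  shows "\<Union>(periodic_orbits f) = {x. (f ^^ map_cyclicity f) x = x}
    \<and> (\<exists>S. bij_betw (restrict_coords (critical_nodes f)) (\<Union>(periodic_orbits f)) S
         \<and> convex S
         \<and> inf_subsemilattice (critical_nodes f) S
         \<and> aff_dim S \<le> int (num_critical_classes (f ^^ map_cyclicity f)))
    \<and> num_critical_classes (f ^^ map_cyclicity f)
        = (\<Sum>G\<in>critical_components f. graph_cyclicity G)"
proof -
  have f: "convex_monotone_map f" using assms by unfold_locales
  obtain v where v: "f v = v" using assms by blast
  define c where "c = map_cyclicity f"
  define E where "E = crit f v"
  interpret f: convex_monotone_map f by (rule f)
  interpret g: convex_monotone_map "f ^^ c" by (rule convex_monotone_map_funpow[OF f])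
  have c: "c > 0" unfolding c_def by (rule f.map_cyclicity_pos[OF v])
  have vc: "(f ^^ c) v = v" by (rule funpow_fixed[of f, OF v])
  have conv: "E\<inverse> \<subseteq> E\<^sup>*" unfolding E_def by (rule f.crit_converse)
  have dvd: "period E S dvd c" if "S \<in> Field E // E\<^sup>*" for S
    using that unfolding c_def f.map_cyclicity_eq[OF v] E_def by (intro dvd_Lcm) simp
  have critc: "crit (f ^^ c) v = E ^^ c" unfolding E_def by (rule crit_funpow[OF f v c])
  have Field_c: "Field (E ^^ c) = Field E" by (rule Field_relpow[OF conv c])
  \<comment> \<open>f and \<open>f ^^ c\<close> share their critical nodes, so the claims about the
    image become the fixed-point results for \<open>f ^^ c\<close>.\<close>
  have nodes: "critical_nodes f = Field (crit (f ^^ c) v)"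
    unfolding f.critical_graph_eq[OF v] critc Field_c by (simp add: rel_graph_def E_def)
  have num: "num_critical_classes (f ^^ c) = card (Field (crit (f ^^ c) v) // (crit (f ^^ c) v)\<^sup>*)"
    unfolding num_critical_classes_def g.critical_classes_eq[OF vc] ..
  have periodic: "\<Union>(periodic_orbits f) = {x. (f ^^ c) x = x}"
    unfolding Union_periodic_orbits
  proof (intro Collect_cong iffI)
    fix x assume "\<exists>p>0. (f ^^ p) x = x"
    then obtain p where "p > 0" "(f ^^ p) x = x" by blast
    then show "(f ^^ c) x = x"
      by (intro periodic_imp_fixed_cyclicity[OF f v c dvd[unfolded E_def]])
  qed (use c in blast)
  let ?S = "restrict_coords (critical_nodes f) ` {x. (f ^^ c) x = x}"
  have "inj_on (restrict_coords (critical_nodes f)) {x. (f ^^ c) x = x}"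
  proof (rule inj_onI)
    fix x y assume "x \<in> {x. (f ^^ c) x = x}" "y \<in> {x. (f ^^ c) x = x}"
      and eq: "restrict_coords (critical_nodes f) x = restrict_coords (critical_nodes f) y"
    then have xy: "(f ^^ c) x = x" "(f ^^ c) y = y" by simp_all
    have "x $ i = y $ i" if "i \<in> Field (crit (f ^^ c) v)" for i
      using arg_cong[OF eq, of "\<lambda>x. x $ i"] that by (simp add: restrict_coords_def nodes)
    note on_crit = this
    show "x = y"
    proof (rule antisym)
      show "x \<le> y" using on_crit by (intro g.fixed_le_if_le_on_critical[OF vc xy]) simp
      show "y \<le> x" using on_crit by (intro g.fixed_le_if_le_on_critical[OF vc xy(2,1)]) simp
    qed
  qed
  then have "bij_betw (restrict_coords (critical_nodes f)) (\<Union>(periodic_orbits f)) ?S"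
    unfolding periodic by (simp add: bij_betw_def)
  moreover have "convex ?S" unfolding nodes by (rule g.convex_fixed_restrict[OF vc])
  moreover have "inf_subsemilattice (critical_nodes f) ?S"
    unfolding nodes by (rule g.inf_subsemilattice_fixed_restrict[OF vc])
  moreover have "aff_dim ?S \<le> int (num_critical_classes (f ^^ c))"
    unfolding nodes num by (rule g.aff_dim_fixed_restrict[OF vc])
  moreover have "num_critical_classes (f ^^ c) = (\<Sum>G\<in>critical_components f. graph_cyclicity G)"
    unfolding num critc Field_c f.sum_graph_cyclicity[OF v] E_def[symmetric]
    by (rule card_quotient_relpow[OF conv c dvd])
  ultimately show ?thesis unfolding c_def[symmetric] using periodic by blast
qed

end
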